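(* Let $G$ be a finite, connected graph that contains at least one cycle. Then $D'(G)\leq D(G)$.
   Context: All graphs are simple. For a graph $G$, ${\rm Aut}(G)$ denotes its automorphism group. A vertex labeling $\phi: V(G)\to\{1,\dots,r\}$ is distinguishing if the only automorphism $\alpha\in{\rm Aut}(G)$ with $\phi(\alpha(x))=\phi(x)$ for all $x\in V(G)$ is the identity. The distinguishing number $D(G)$ is the smallest $r$ such that $G$ admits a distinguishing vertex labeling with $r$ labels. Analogously, an edge labeling $\psi:E(G)\to\{1,\dots,d\}$ is distinguishing if the only automorphism of $G$ preserving all edge labels (i.e. $\psi(\alpha(x)\alpha(y))=\psi(xy)$ for every edge $xy$) is the identity; the distinguishing index $D'(G)$ is the smallest $d$ such that $G$ admits a distinguishing edge labeling with $d$ labels. *)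

theory Defs
  imports Main
begin

text \<open>A finite simple graph: finite vertex set V and edge set E of 2-element subsets of V.\<close>
definition simple_graph :: "'a set \<Rightarrow> 'a set set \<Rightarrow> bool" where
  "simple_graph V E \<longleftrightarrow> finite V \<and> (\<forall>e\<in>E. \<exists>u v. e = {u, v} \<and> u \<noteq> v \<and> u \<in> V \<and> v \<in> V)"

definition adj_rel :: "'a set set \<Rightarrow> ('a \<times> 'a) set" where
  "adj_rel E = {(u, v). {u, v} \<in> E}"

definition connected_graph :: "'a set \<Rightarrow> 'a set set \<Rightarrow> bool" where
  "connected_graph V E \<longleftrightarrow> V \<noteq> {} \<and> (\<forall>u\<in>V. \<forall>v\<in>V. (u, v) \<in> (adj_rel E)\<^sup>*)"

text \<open>A cycle: at least 3 distinct vertices, consecutive ones adjacent, and last adjacent to first.\<close>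
definition has_cycle :: "'a set \<Rightarrow> 'a set set \<Rightarrow> bool" where
  "has_cycle V E \<longleftrightarrow> (\<exists>xs. length xs \<ge> 3 \<and> distinct xs \<and> set xs \<subseteq> V \<and>
     (\<forall>i. Suc i < length xs \<longrightarrow> {xs ! i, xs ! Suc i} \<in> E) \<and> {last xs, hd xs} \<in> E)"

text \<open>Automorphisms, as permutations of V (identity outside V) preserving adjacency.\<close>
definition automorphisms :: "'a set \<Rightarrow> 'a set set \<Rightarrow> ('a \<Rightarrow> 'a) set" where
  "automorphisms V E = {\<alpha>. bij_betw \<alpha> V V \<and> (\<forall>x. x \<notin> V \<longrightarrow> \<alpha> x = x) \<and>
     (\<forall>u\<in>V. \<forall>v\<in>V. {u, v} \<in> E \<longleftrightarrow> {\<alpha> u, \<alpha> v} \<in> E)}"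

definition distinguishing_vertex_labeling :: "'a set \<Rightarrow> 'a set set \<Rightarrow> ('a \<Rightarrow> nat) \<Rightarrow> bool" where
  "distinguishing_vertex_labeling V E \<phi> \<longleftrightarrow>
     (\<forall>\<alpha>\<in>automorphisms V E. (\<forall>x\<in>V. \<phi> (\<alpha> x) = \<phi> x) \<longrightarrow> (\<forall>x\<in>V. \<alpha> x = x))"

definition distinguishing_edge_labeling :: "'a set \<Rightarrow> 'a set set \<Rightarrow> ('a set \<Rightarrow> nat) \<Rightarrow> bool" where
  "distinguishing_edge_labeling V E \<psi> \<longleftrightarrow>
     (\<forall>\<alpha>\<in>automorphisms V E. (\<forall>x y. {x, y} \<in> E \<longrightarrow> \<psi> {\<alpha> x, \<alpha> y} = \<psi> {x, y}) \<longrightarrow> (\<forall>x\<in>V. \<alpha> x = x))"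

text \<open>Distinguishing number D(G) and distinguishing index D'(G).\<close>
definition distinguishing_number :: "'a set \<Rightarrow> 'a set set \<Rightarrow> nat" where
  "distinguishing_number V E = (LEAST r. \<exists>\<phi>. (\<forall>x\<in>V. \<phi> x \<in> {1..r}) \<and> distinguishing_vertex_labeling V E \<phi>)"

definition distinguishing_index :: "'a set \<Rightarrow> 'a set set \<Rightarrow> nat" where
  "distinguishing_index V E = (LEAST d. \<exists>\<psi>. (\<forall>e\<in>E. \<psi> e \<in> {1..d}) \<and> distinguishing_edge_labeling V E \<psi>)"

end

theory Submission
  imports Defs
begin

text \<open>
  Let \<open>\<phi>\<close> be a distinguishing vertex labeling with \<open>r = D(G)\<close> labels, and call a set of edges a boundary
  if it consists of the edges with exactly one end in some vertex set.

  Breadth-first labelings: for a vertex set \<open>S\<close>, label the edge from each vertex \<open>v\<close> outside \<open>S\<close> to its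
  breadth-first parent by \<open>\<phi> v\<close> and the other edges not inside \<open>S\<close> by \<open>r\<close>. A label-preserving automorphism
  that maps \<open>S\<close> to itself preserves \<open>\<phi>\<close> outside \<open>S\<close>, so only \<open>S\<close> has to be taken care of. If \<open>r \<ge> 3\<close> and \<open>S\<close>
  carries a subgraph of minimum degree 2 labeled with 1 and 2, that subgraph is the 2-core of the
  edges with label other than \<open>r\<close> and hence is preserved. If there is more than one cycle, such a
  subgraph with a rigid labeling is a path both of whose ends have a further neighbour on the path.
  If there is only one cycle, it is preserved anyway and is labeled by hand.

  For \<open>r = 2\<close> and more than one cycle let \<open>A\<close> be the set of vertices with label 2. The boundary of \<open>A\<close>
  distinguishes unless some automorphism \<open>\<alpha>\<close> exchanges \<open>A\<close> and its complement. In that case change the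
  label of one edge \<open>e\<close>: an automorphism \<open>\<beta>\<close> preserving the result makes \<open>{e, \<beta> e}\<close> a boundary or fixes \<open>e\<close>.
  This settles the case of an edge \<open>e\<close> moved by \<open>\<alpha>\<close> that lies in no 2-edge cut. Otherwise a side \<open>W\<close> of
  a 2-edge cut \<open>{e, e'}\<close>, maximal among the sides not split by a further edge parallel to \<open>e\<close>, is
  preserved, and making the labels of \<open>e\<close> and \<open>e'\<close> different fixes the ends of both.
\<close>

section \<open>Automorphisms and edge boundaries\<close>

text \<open>The condition is put on edges as sets rather than on pairs of ends, so that images of
  edge sets under automorphisms can be used directly. The final theorem translates it into
  \<open>distinguishing_edge_labeling\<close>.\<close>

definition edge_distinguishable :: "'a set \<Rightarrow> 'a set set \<Rightarrow> nat \<Rightarrow> bool" where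
  "edge_distinguishable V E r \<longleftrightarrow>
     (\<exists>\<psi>. (\<forall>e\<in>E. \<psi> e \<in> {1..r}) \<and>
        (\<forall>\<beta>\<in>automorphisms V E. (\<forall>e\<in>E. \<psi> (\<beta> ` e) = \<psi> e) \<longrightarrow> (\<forall>x\<in>V. \<beta> x = x)))"

definition symdiff :: "'a set \<Rightarrow> 'a set \<Rightarrow> 'a set" (infixl "\<triangle>" 65) where
  "A \<triangle> B = (A - B) \<union> (B - A)"

lemma in_symdiff_iff: "x \<in> A \<triangle> B \<longleftrightarrow> (x \<in> A) \<noteq> (x \<in> B)"
  by (auto simp: symdiff_def)

lemma image_symdiff: "inj f \<Longrightarrow> f ` (A \<triangle> B) = (f ` A) \<triangle> (f ` B)"
  by (simp add: symdiff_def image_Un image_set_diff)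

lemma symdiff_empty_iff: "A \<triangle> B = {} \<longleftrightarrow> A = B"
  by (auto simp: symdiff_def)

lemma inj_image_set: "inj f \<Longrightarrow> inj ((`) f)"
  by (simp add: inj_on_def inj_image_eq_iff)

section \<open>Rigidity of paths\<close>

definition walk_edges :: "(nat \<Rightarrow> 'a) \<Rightarrow> nat \<Rightarrow> nat \<Rightarrow> 'a set set" where
  "walk_edges v a b = {{v t, v (Suc t)} | t. a \<le> t \<and> t < b}"

text \<open>Injectivity forbids turning back, so the direction of the first step is kept throughout.
  As all values stay in an interval of the same length, the first value is \<open>a\<close> or
  \<open>b\<close>.\<close>

lemma unit_step_injection:
  fixes \<sigma> :: "nat \<Rightarrow> nat"
  assumes inj: "inj_on \<sigma> {a..b}" and "a < b"
    and step: "\<And>t. a \<le> t \<Longrightarrow> t < b \<Longrightarrow> \<sigma> (Suc t) = Suc (\<sigma> t) \<or> \<sigma> t = Suc (\<sigma> (Suc t))"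
    and range: "\<And>t. a \<le> t \<Longrightarrow> t \<le> b \<Longrightarrow> a \<le> \<sigma> t \<and> \<sigma> t \<le> b"
  shows "(\<forall>t. a \<le> t \<longrightarrow> t \<le> b \<longrightarrow> \<sigma> t = t) \<or> (\<forall>t. a \<le> t \<longrightarrow> t \<le> b \<longrightarrow> \<sigma> t = a + b - t)"
proof -
  have ne: "\<sigma> (Suc (Suc t)) \<noteq> \<sigma> t" if "a \<le> t" "Suc (Suc t) \<le> b" for t
    using inj that by (auto dest!: inj_onD)
  consider "\<sigma> (Suc a) = Suc (\<sigma> a)" | "\<sigma> a = Suc (\<sigma> (Suc a))"
    using step[of a] \<open>a < b\<close> by auto
  then show ?thesis
  proof cases
    case 1
    have *: "Suc (a + k) \<le> b \<longrightarrow> \<sigma> (Suc (a + k)) = Suc (\<sigma> (a + k)) \<and> \<sigma> (a + k) = \<sigma> a + k" for k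
    proof (induction k)
      case 0 then show ?case using 1 by simp
    next
      case (Suc k)
      show ?case
      proof
        assume le: "Suc (a + Suc k) \<le> b"
        then have IH: "\<sigma> (Suc (a + k)) = Suc (\<sigma> (a + k))" "\<sigma> (a + k) = \<sigma> a + k"
          using Suc by auto
        show "\<sigma> (Suc (a + Suc k)) = Suc (\<sigma> (a + Suc k)) \<and> \<sigma> (a + Suc k) = \<sigma> a + Suc k"
          using step[of "a + Suc k"] ne[of "a + k"] le IH by auto
      qed
    qed
    have val: "\<sigma> t = \<sigma> a + (t - a)" if t: "a \<le> t" "t \<le> b" for t
    proof (cases "t = a")
      case False
      with t have "a < t" by simp
      then obtain k where "t = Suc (a + k)" using less_imp_Suc_add by blast
      then show ?thesis using *[of k] t by auto
    qed simp
    have "\<sigma> a = a" using val[of b] range[of a] range[of b] \<open>a < b\<close> by auto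
    then show ?thesis using val by auto
  next
    case 2
    have *: "Suc (a + k) \<le> b \<longrightarrow> \<sigma> (a + k) = Suc (\<sigma> (Suc (a + k))) \<and> \<sigma> (a + k) + k = \<sigma> a" for k
    proof (induction k)
      case 0 then show ?case using 2 by simp
    next
      case (Suc k)
      show ?case
      proof
        assume le: "Suc (a + Suc k) \<le> b"
        then have IH: "\<sigma> (a + k) = Suc (\<sigma> (Suc (a + k)))" "\<sigma> (a + k) + k = \<sigma> a"
          using Suc by auto
        show "\<sigma> (a + Suc k) = Suc (\<sigma> (Suc (a + Suc k))) \<and> \<sigma> (a + Suc k) + Suc k = \<sigma> a"
          using step[of "a + Suc k"] ne[of "a + k"] le IH by auto
      qed
    qed
    have val: "\<sigma> t + (t - a) = \<sigma> a" if t: "a \<le> t" "t \<le> b" for t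
    proof (cases "t = a")
      case False
      with t have "a < t" by simp
      then obtain k where "t = Suc (a + k)" using less_imp_Suc_add by blast
      then show ?thesis using *[of k] t by auto
    qed simp
    have "\<sigma> a = b" using val[of b] range[of a] range[of b] \<open>a < b\<close> by auto
    then have "\<sigma> t = a + b - t" if "a \<le> t" "t \<le> b" for t using val[OF that] that by auto
    then show ?thesis by blast
  qed
qed

text \<open>The map \<beta> acts on the indices by an injection \<sigma>. Images of consecutive
  vertices are joined by an edge of the path, so \<sigma> moves by unit steps.\<close>

lemma path_rigid:
  assumes v: "inj_on v {a..b}" and "a < b" and \<beta>: "inj \<beta>"
    and pres: "(`) \<beta> ` walk_edges v a b \<subseteq> walk_edges v a b"
  shows "(\<forall>t. a \<le> t \<longrightarrow> t \<le> b \<longrightarrow> \<beta> (v t) = v t) \<or>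
         (\<forall>t. a \<le> t \<longrightarrow> t \<le> b \<longrightarrow> \<beta> (v t) = v (a + b - t))"
proof -
  have edge: "\<exists>s. a \<le> s \<and> s < b \<and> {\<beta> (v t), \<beta> (v (Suc t))} = {v s, v (Suc s)}" if "a \<le> t" "t < b" for t
  proof -
    have "\<beta> ` {v t, v (Suc t)} \<in> walk_edges v a b"
      by (rule subsetD[OF pres], rule imageI) (use that in \<open>auto simp: walk_edges_def\<close>)
    then show ?thesis by (auto simp: walk_edges_def)
  qed
  have "\<exists>s. a \<le> s \<and> s \<le> b \<and> \<beta> (v t) = v s" if t: "a \<le> t" "t \<le> b" for t
  proof (cases "t < b")
    case True
    then obtain s where "a \<le> s" "s < b" "{\<beta> (v t), \<beta> (v (Suc t))} = {v s, v (Suc s)}"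
      using edge t by blast
    then have "\<beta> (v t) = v s \<or> \<beta> (v t) = v (Suc s)" by (auto simp: doubleton_eq_iff)
    then show ?thesis using \<open>a \<le> s\<close> \<open>s < b\<close> by (auto intro: exI[of _ s] exI[of _ "Suc s"])
  next
    case False
    then have "t = Suc (t - 1)" "a \<le> t - 1" "t - 1 < b" using t \<open>a < b\<close> by auto
    then obtain u where u: "t = Suc u" "a \<le> u" "u < b" by blast
    then obtain s where "a \<le> s" "s < b" "{\<beta> (v u), \<beta> (v (Suc u))} = {v s, v (Suc s)}"
      using edge by blast
    then have "\<beta> (v t) = v s \<or> \<beta> (v t) = v (Suc s)" using u by (auto simp: doubleton_eq_iff)
    then show ?thesis using \<open>a \<le> s\<close> \<open>s < b\<close> by (auto intro: exI[of _ s] exI[of _ "Suc s"])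
  qed
  then obtain \<sigma> where \<sigma>: "\<And>t. a \<le> t \<Longrightarrow> t \<le> b \<Longrightarrow> a \<le> \<sigma> t \<and> \<sigma> t \<le> b \<and> \<beta> (v t) = v (\<sigma> t)"
    by metis
  have inj: "inj_on \<sigma> {a..b}"
  proof (rule inj_onI)
    fix s t assume st: "s \<in> {a..b}" "t \<in> {a..b}" "\<sigma> s = \<sigma> t"
    then have "\<beta> (v s) = \<beta> (v t)" using \<sigma> by simp
    then have "v s = v t" using \<beta> by (simp add: inj_eq)
    then show "s = t" using inj_onD[OF v] st by blast
  qed
  have step: "\<sigma> (Suc t) = Suc (\<sigma> t) \<or> \<sigma> t = Suc (\<sigma> (Suc t))" if t: "a \<le> t" "t < b" for t
  proof -
    obtain s where s: "a \<le> s" "s < b" "{\<beta> (v t), \<beta> (v (Suc t))} = {v s, v (Suc s)}"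
      using edge t by blast
    have "{v (\<sigma> t), v (\<sigma> (Suc t))} = {v s, v (Suc s)}"
      using s(3) \<sigma>[of t] \<sigma>[of "Suc t"] t by simp
    then have "(v (\<sigma> t) = v s \<and> v (\<sigma> (Suc t)) = v (Suc s)) \<or> (v (\<sigma> t) = v (Suc s) \<and> v (\<sigma> (Suc t)) = v s)"
      by (simp add: doubleton_eq_iff)
    moreover have "\<sigma> t \<in> {a..b}" "\<sigma> (Suc t) \<in> {a..b}" "s \<in> {a..b}" "Suc s \<in> {a..b}"
      using \<sigma>[of t] \<sigma>[of "Suc t"] t s by auto
    ultimately have "(\<sigma> t = s \<and> \<sigma> (Suc t) = Suc s) \<or> (\<sigma> t = Suc s \<and> \<sigma> (Suc t) = s)"
      using inj_onD[OF v] by metis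
    then show ?thesis by auto
  qed
  from unit_step_injection[OF inj \<open>a < b\<close> step] \<sigma> show ?thesis by auto
qed

section \<open>Connected simple graphs, their automorphisms and the boundaries of vertex
  sets\<close>

locale connected_simple_graph =
  fixes V :: "'a set" and E :: "'a set set"
  assumes simple: "simple_graph V E" and conn: "connected_graph V E"
begin

lemma finite_V: "finite V" using simple by (simp add: simple_graph_def)

lemma edge_cases:
  assumes "e \<in> E" obtains u w where "e = {u, w}" "u \<noteq> w" "u \<in> V" "w \<in> V"
  using assms simple unfolding simple_graph_def by blast

lemma edgeD: "{u, w} \<in> E \<Longrightarrow> u \<noteq> w \<and> u \<in> V \<and> w \<in> V"
proof -
  assume "{u, w} \<in> E"
  then obtain x y where "{u, w} = {x, y}" "x \<noteq> y" "x \<in> V" "y \<in> V" by (rule edge_cases)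
  then show ?thesis by (auto simp: doubleton_eq_iff)
qed

lemma edge_subset: "e \<in> E \<Longrightarrow> e \<subseteq> V" by (erule edge_cases) auto

lemma finite_E: "finite E"
  by (rule finite_subset[of _ "Pow V"]) (auto simp: finite_V dest: edge_subset)

lemma connected_induct:
  assumes "u \<in> V" "P u" and step: "\<And>x y. {x, y} \<in> E \<Longrightarrow> P x \<Longrightarrow> P y" and "w \<in> V"
  shows "P w"
proof -
  have "(u, w) \<in> (adj_rel E)\<^sup>*" using conn assms unfolding connected_graph_def by blast
  then show ?thesis
    by (induction rule: rtrancl_induct) (use assms in \<open>auto simp: adj_rel_def\<close>)
qed

text \<open>The convention that automorphisms are the identity outside \<open>V\<close> makes them
  bijections of the whole type, so \<open>inj\<close> and preimages can be used without reference to
  \<open>V\<close>.\<close>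

lemma aut_bij: assumes "\<beta> \<in> automorphisms V E" shows "bij \<beta>"
proof -
  have 1: "bij_betw \<beta> V V" and 2: "\<And>x. x \<notin> V \<Longrightarrow> \<beta> x = x"
    using assms by (auto simp: automorphisms_def)
  have "bij_betw \<beta> (- V) (- V)" using 2 by (auto simp: bij_betw_def inj_on_def image_iff)
  from bij_betw_combine[OF 1 this] show ?thesis by simp
qed

lemma aut_inj: "\<beta> \<in> automorphisms V E \<Longrightarrow> inj \<beta>"
  by (simp add: aut_bij bij_is_inj)

lemma aut_image_V: "\<beta> \<in> automorphisms V E \<Longrightarrow> \<beta> ` V = V"
  by (simp add: automorphisms_def bij_betw_def)

lemma aut_in_V_iff: "\<beta> \<in> automorphisms V E \<Longrightarrow> \<beta> x \<in> V \<longleftrightarrow> x \<in> V"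
  by (metis aut_image_V aut_inj inj_image_mem_iff)

lemma aut_edge_iff: "\<beta> \<in> automorphisms V E \<Longrightarrow> {\<beta> u, \<beta> w} \<in> E \<longleftrightarrow> {u, w} \<in> E"
proof (cases "u \<in> V \<and> w \<in> V")
  case True
  assume "\<beta> \<in> automorphisms V E"
  then show ?thesis using True by (auto simp: automorphisms_def)
next
  case False
  assume "\<beta> \<in> automorphisms V E"
  then show ?thesis using False edgeD[of u w] edgeD[of "\<beta> u" "\<beta> w"] aut_in_V_iff by blast
qed

lemma aut_image_edge: "\<beta> \<in> automorphisms V E \<Longrightarrow> e \<in> E \<Longrightarrow> \<beta> ` e \<in> E"
proof -
  assume \<beta>: "\<beta> \<in> automorphisms V E" and "e \<in> E"
  then obtain u w where "e = {u, w}" using edge_cases by blast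
  then show ?thesis using aut_edge_iff[OF \<beta>, of u w] \<open>e \<in> E\<close> by simp
qed

lemma aut_image_E: "\<beta> \<in> automorphisms V E \<Longrightarrow> (`) \<beta> ` E = E"
proof (rule endo_inj_surj[OF finite_E])
  assume \<beta>: "\<beta> \<in> automorphisms V E"
  show "(`) \<beta> ` E \<subseteq> E" using aut_image_edge[OF \<beta>] by blast
  show "inj_on ((`) \<beta>) E" using inj_image_set[OF aut_inj[OF \<beta>]] inj_on_subset by blast
qed

lemma aut_comp: "\<alpha> \<in> automorphisms V E \<Longrightarrow> \<beta> \<in> automorphisms V E \<Longrightarrow> \<alpha> \<circ> \<beta> \<in> automorphisms V E"
proof -
  assume \<alpha>: "\<alpha> \<in> automorphisms V E" and \<beta>: "\<beta> \<in> automorphisms V E"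
  have "bij_betw (\<alpha> \<circ> \<beta>) V V"
    using \<alpha> \<beta> unfolding automorphisms_def by (blast intro: bij_betw_trans)
  moreover have "\<alpha> (\<beta> x) = x" if "x \<notin> V" for x
    using \<alpha> \<beta> that unfolding automorphisms_def by simp
  ultimately show "\<alpha> \<circ> \<beta> \<in> automorphisms V E"
    by (simp add: automorphisms_def aut_edge_iff[OF \<alpha>] aut_edge_iff[OF \<beta>])
qed

text \<open>The set \<open>X\<close> may contain points outside \<open>V\<close>; they have no
  influence (\<open>bd_Int_V\<close>). This permits complements \<open>- X\<close> and preimages
  without intersecting with \<open>V\<close>.\<close>

definition bd :: "'a set \<Rightarrow> 'a set set" where
  "bd X = {e \<in> E. e \<inter> X \<noteq> {} \<and> \<not> e \<subseteq> X}"

lemma in_bd_iff: "{u, w} \<in> bd X \<longleftrightarrow> {u, w} \<in> E \<and> (u \<in> X) \<noteq> (w \<in> X)"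
  by (auto simp: bd_def)

lemma bd_subset: "bd X \<subseteq> E" by (auto simp: bd_def)

lemma bd_compl: "bd (- X) = bd X"
  by (auto simp: bd_def)

lemma bd_Int_V: "bd (X \<inter> V) = bd X"
proof -
  have "e \<inter> (X \<inter> V) = e \<inter> X" "e \<subseteq> X \<inter> V \<longleftrightarrow> e \<subseteq> X" if "e \<in> E" for e
    using edge_subset[OF that] by auto
  then show ?thesis unfolding bd_def by auto
qed

text \<open>The boundary map is linear over the two-element field, with \<triangle> as addition: an
  edge is in the boundary iff an odd number of its ends is in the set.\<close>

lemma bd_symdiff: "bd (X \<triangle> Y) = bd X \<triangle> bd Y"
proof (rule set_eqI)
  fix e show "e \<in> bd (X \<triangle> Y) \<longleftrightarrow> e \<in> bd X \<triangle> bd Y"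
  proof (cases "e \<in> E")
    case True
    then show ?thesis by (elim edge_cases) (auto simp: in_bd_iff in_symdiff_iff)
  qed (use bd_subset in \<open>auto simp: in_symdiff_iff\<close>)
qed

text \<open>This is the kernel of the boundary map: membership in \<open>X\<close> is constant along
  edges, hence on the connected graph.\<close>

lemma bd_empty_cases: assumes "bd X = {}" shows "V \<subseteq> X \<or> X \<inter> V = {}"
proof (cases "X \<inter> V = {}")
  case False
  then obtain u where "u \<in> V" "u \<in> X" by auto
  then have "w \<in> X" if "w \<in> V" for w
    by (rule connected_induct) (use assms that in_bd_iff in auto)
  then show ?thesis by auto
qed simp

lemma bd_image: assumes "\<beta> \<in> automorphisms V E" shows "bd (\<beta> ` X) = (`) \<beta> ` bd X"
proof -
  have "e \<in> (`) \<beta> ` bd X" if "e \<in> bd (\<beta> ` X)" for e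
  proof -
    have "e \<in> (`) \<beta> ` E" using that aut_image_E[OF assms] bd_subset by blast
    then obtain f where f: "e = \<beta> ` f" "f \<in> E" by auto
    have "f \<in> bd X"
      using that f aut_inj[OF assms]
      by (simp add: bd_def inj_image_subset_iff flip: image_Int)
    then show ?thesis using f by blast
  qed
  moreover have "\<beta> ` f \<in> bd (\<beta> ` X)" if "f \<in> bd X" for f
    using that aut_image_edge[OF assms] aut_inj[OF assms]
    by (simp add: bd_def inj_image_subset_iff flip: image_Int)
  ultimately show ?thesis by blast
qed

end

section \<open>Two-edge cuts\<close>

context connected_simple_graph
begin

text \<open>These are the edges that lie on cycles, expressed by cuts only.\<close>

definition nonbridge :: "'a set \<Rightarrow> bool" where
  "nonbridge e \<longleftrightarrow> e \<in> E \<and> (\<forall>X. bd X \<noteq> {e})"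

definition cut_pair :: "'a set \<Rightarrow> 'a set \<Rightarrow> bool" where
  "cut_pair e f \<longleftrightarrow> (\<exists>X. bd X = {e, f})"

definition single :: "'a set \<Rightarrow> bool" where
  "single e \<longleftrightarrow> nonbridge e \<and> (\<forall>f. \<not> cut_pair e f)"

lemma cut_pair_commute: "cut_pair e f \<longleftrightarrow> cut_pair f e"
proof -
  have "{e, f} = {f, e}" by blast
  then show ?thesis unfolding cut_pair_def by simp
qed

text \<open>In the sum of the two boundaries the common edge \<open>f\<close> cancels.\<close>

lemma cut_pair_trans:
  assumes "cut_pair e f" "cut_pair f g" "e \<noteq> f" "f \<noteq> g" "e \<noteq> g"
  shows "cut_pair e g"
proof -
  obtain X Y where "bd X = {e, f}" "bd Y = {f, g}" using assms by (auto simp: cut_pair_def)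
  moreover have "{e, f} \<triangle> {f, g} = {e, g}" using assms(3-5) unfolding symdiff_def by blast
  ultimately have "bd (X \<triangle> Y) = {e, g}" by (simp add: bd_symdiff)
  then show ?thesis by (auto simp: cut_pair_def)
qed

text \<open>If \<open>f\<close> were a cut by itself, adding it to the cut with edges
  \<open>e\<close> and \<open>f\<close> would leave \<open>e\<close> alone.\<close>

lemma nonbridge_cut_pair:
  assumes "nonbridge e" "cut_pair e f" shows "nonbridge f" "e \<noteq> f"
proof -
  obtain X where X: "bd X = {e, f}" using assms by (auto simp: cut_pair_def)
  show "e \<noteq> f" using X assms(1) by (auto simp: nonbridge_def)
  then have "{e, f} \<triangle> {f} = {e}" unfolding symdiff_def by blast
  moreover have "bd (X \<triangle> Y) \<noteq> {e}" for Y using assms(1) by (simp add: nonbridge_def)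
  ultimately have "bd Y \<noteq> {f}" for Y using X by (metis bd_symdiff)
  moreover have "f \<in> E" using X bd_subset[of X] by simp
  ultimately show "nonbridge f" by (simp add: nonbridge_def)
qed

text \<open>Equality is added for reflexivity. On \<open>nonbridge\<close> edges the relation is
  then an equivalence, whose classes collect the edges that pairwise form two-edge cuts.\<close>

definition parallel :: "'a set \<Rightarrow> 'a set set" where
  "parallel e = {f. f = e \<or> cut_pair e f}"

lemma parallelI: "bd X = {e, f} \<Longrightarrow> f \<in> parallel e"
  by (auto simp: parallel_def cut_pair_def)

lemma parallel_trans:
  assumes "nonbridge e" "f \<in> parallel e" "g \<in> parallel f" shows "g \<in> parallel e"
proof -
  have "f = e \<or> cut_pair e f" "g = f \<or> cut_pair f g" using assms by (auto simp: parallel_def)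
  moreover have "cut_pair e g" if "cut_pair e f" "cut_pair f g" "e \<noteq> g"
  proof (rule cut_pair_trans[OF that(1,2) _ _ that(3)])
    show "e \<noteq> f" by (rule nonbridge_cut_pair(2)[OF assms(1) that(1)])
    show "f \<noteq> g" by (rule nonbridge_cut_pair(2)[OF nonbridge_cut_pair(1)[OF assms(1) that(1)] that(2)])
  qed
  ultimately show ?thesis unfolding parallel_def by blast
qed

lemma parallel_sym: "f \<in> parallel e \<Longrightarrow> e \<in> parallel f"
  unfolding parallel_def using cut_pair_commute[of e f] by blast

lemma parallel_nonbridge: "nonbridge e \<Longrightarrow> f \<in> parallel e \<Longrightarrow> nonbridge f"
  unfolding parallel_def using nonbridge_cut_pair(1)[of e f] by blast

text \<open>Every set is the image of its preimage under the bijection \<beta>, so cuts can be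
  pulled back as well as pushed forward.\<close>

lemma nonbridge_image:
  assumes \<beta>: "\<beta> \<in> automorphisms V E" shows "nonbridge (\<beta> ` e) \<longleftrightarrow> nonbridge e"
proof -
  have inj: "inj ((`) \<beta>)" by (rule inj_image_set[OF aut_inj[OF \<beta>]])
  have "\<beta> ` e \<in> E \<longleftrightarrow> e \<in> E"
    using aut_image_E[OF \<beta>] inj_image_mem_iff[OF inj, of e E] by simp
  moreover have "(\<exists>X. bd X = {\<beta> ` e}) \<longleftrightarrow> (\<exists>X. bd X = {e})"
  proof
    assume "\<exists>X. bd X = {\<beta> ` e}"
    then obtain X where X: "bd X = {\<beta> ` e}" by blast
    obtain Y where "X = \<beta> ` Y"
      using surj_image_vimage_eq[OF bij_is_surj[OF aut_bij[OF \<beta>]], of X] by metis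
    then have "(`) \<beta> ` bd Y = (`) \<beta> ` {e}" using X bd_image[OF \<beta>] by simp
    then have "bd Y = {e}" by (rule inj_image_eq_iff[OF inj, THEN iffD1])
    then show "\<exists>X. bd X = {e}" by blast
  next
    assume "\<exists>X. bd X = {e}"
    then obtain X where "bd X = {e}" by blast
    then have "bd (\<beta> ` X) = {\<beta> ` e}" using bd_image[OF \<beta>, of X] by simp
    then show "\<exists>X. bd X = {\<beta> ` e}" by blast
  qed
  ultimately show ?thesis by (auto simp: nonbridge_def)
qed

lemma cut_pair_image:
  assumes \<beta>: "\<beta> \<in> automorphisms V E" shows "cut_pair (\<beta> ` e) (\<beta> ` f) \<longleftrightarrow> cut_pair e f"
proof -
  have inj: "inj ((`) \<beta>)" by (rule inj_image_set[OF aut_inj[OF \<beta>]])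
  show ?thesis
  proof
    assume "cut_pair (\<beta> ` e) (\<beta> ` f)"
    then obtain X where X: "bd X = {\<beta> ` e, \<beta> ` f}" by (auto simp: cut_pair_def)
    obtain Y where "X = \<beta> ` Y"
      using surj_image_vimage_eq[OF bij_is_surj[OF aut_bij[OF \<beta>]], of X] by metis
    then have "(`) \<beta> ` bd Y = (`) \<beta> ` {e, f}" using X bd_image[OF \<beta>] by simp
    then have "bd Y = {e, f}" by (rule inj_image_eq_iff[OF inj, THEN iffD1])
    then show "cut_pair e f" by (auto simp: cut_pair_def)
  next
    assume "cut_pair e f"
    then obtain X where "bd X = {e, f}" by (auto simp: cut_pair_def)
    then have "bd (\<beta> ` X) = {\<beta> ` e, \<beta> ` f}" using bd_image[OF \<beta>, of X] by simp
    then show "cut_pair (\<beta> ` e) (\<beta> ` f)" by (auto simp: cut_pair_def)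
  qed
qed

lemma parallel_image:
  assumes \<beta>: "\<beta> \<in> automorphisms V E" shows "\<beta> ` f \<in> parallel (\<beta> ` e) \<longleftrightarrow> f \<in> parallel e"
  by (simp add: parallel_def cut_pair_image[OF \<beta>] inj_image_eq_iff[OF aut_inj[OF \<beta>]])

text \<open>Let \<open>R\<close> be the component of \<open>w\<close> after removal of
  \<open>u\<close> and \<open>e\<close>. Its boundary edges meet \<open>u\<close> or equal
  \<open>e\<close>, and by assumption there is one other than \<open>{u, w}\<close> and
  \<open>e\<close>. This edge \<open>{u, z}\<close> lies with \<open>{u, w}\<close> on a cycle
  through \<open>R\<close> that avoids \<open>e\<close>, so it is neither a bridge nor in a two-edge
  cut with \<open>e\<close>.\<close>

lemma adjacent_nonbridge:
  assumes f: "{u, w} \<in> E" "nonbridge {u, w}" "\<not> cut_pair e {u, w}" "{u, w} \<noteq> e"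
  obtains z where "z \<noteq> w" "{u, z} \<noteq> e" "nonbridge {u, z}" "\<not> cut_pair e {u, z}"
proof -
  define Q where "Q = {(x, y). {x, y} \<in> E \<and> {x, y} \<noteq> e \<and> x \<noteq> u \<and> y \<noteq> u}"
  define R where "R = Q\<^sup>* `` {w}"
  have uw: "u \<noteq> w" using f edgeD by blast
  have wR: "w \<in> R" by (simp add: R_def)
  have uR: "u \<notin> R"
  proof
    assume "u \<in> R"
    then have "(w, u) \<in> Q\<^sup>*" by (simp add: R_def)
    then show False using uw by (cases rule: rtranclE) (auto simp: Q_def)
  qed
  have bdR: "u \<in> g \<or> g = e" if g: "g \<in> bd R" for g
  proof -
    obtain x y where g': "g = {x, y}" "x \<noteq> y" using g bd_subset edge_cases by blast
    have E': "{x, y} \<in> E" "(x \<in> R) \<noteq> (y \<in> R)" using g g' in_bd_iff by auto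
    have "(x, y) \<in> Q \<and> (y, x) \<in> Q" if "u \<notin> g" "g \<noteq> e"
      using that E' g' by (auto simp: Q_def insert_commute)
    moreover have "y \<in> R" if "x \<in> R" "(x, y) \<in> Q" for x y
      using that by (auto simp: R_def intro: rtrancl_into_rtrancl)
    ultimately show ?thesis using E'(2) by blast
  qed
  have fR: "{u, w} \<in> bd R" using f(1) wR uR by (simp add: in_bd_iff)
  have "bd R \<noteq> {{u, w}}" "bd R \<noteq> {e, {u, w}}"
    using f by (auto simp: nonbridge_def cut_pair_def)
  then obtain g where g: "g \<in> bd R" "g \<noteq> {u, w}" "g \<noteq> e" using fR by blast
  then have "u \<in> g" using bdR by blast
  have "g \<in> E" using g bd_subset by blast
  then obtain z where z: "g = {u, z}" "z \<noteq> u" using \<open>u \<in> g\<close> edge_cases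
    by (metis doubleton_eq_iff empty_iff insertE)
  have zR: "z \<in> R" using g(1) uR z by (auto simp: in_bd_iff)
  \<comment> \<open>The edge \<open>{u, w}\<close> followed by a walk from \<open>w\<close> to
    \<open>z\<close> inside \<open>R\<close> stays on one side of \<open>X\<close>, but
    \<open>g\<close> joins the ends of this walk.\<close>
  have *: False if X: "g \<in> bd X" "bd X \<subseteq> {g, e}" for X
  proof -
    have "(w \<in> X) = (y \<in> X)" if "(w, y) \<in> Q\<^sup>*" for y
      using that
    proof (induction rule: rtrancl_induct)
      case (step x y)
      then have "u \<notin> {x, y}" "{x, y} \<noteq> e" by (auto simp: Q_def)
      then have "{x, y} \<notin> bd X" using X(2) \<open>u \<in> g\<close> by blast
      moreover have "{x, y} \<in> E" using step by (simp add: Q_def)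
      ultimately show ?case using step.IH by (simp add: in_bd_iff)
    qed simp
    then have "(w \<in> X) = (z \<in> X)" using zR by (simp add: R_def)
    moreover have "{u, w} \<notin> bd X" using X g f by blast
    ultimately have "(u \<in> X) = (z \<in> X)" using f(1) by (simp add: in_bd_iff)
    then show False using X(1) z by (simp add: in_bd_iff)
  qed
  show ?thesis
  proof (rule that[of z])
    show "z \<noteq> w" "{u, z} \<noteq> e" using g z by auto
    show "nonbridge {u, z}" using * \<open>g \<in> E\<close> z unfolding nonbridge_def by blast
    show "\<not> cut_pair e {u, z}" using * z unfolding cut_pair_def by blast
  qed
qed

text \<open>Removal of the class of \<open>e\<close> leaves pieces that are arranged in a ring; a
  solid set is one of these pieces.\<close>

definition solid :: "'a set \<Rightarrow> 'a set \<Rightarrow> 'a set \<Rightarrow> bool" where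
  "solid W e e' \<longleftrightarrow> W \<subseteq> V \<and> nonbridge e \<and> e \<noteq> e' \<and> bd W = {e, e'} \<and>
     (\<forall>f\<in>E. f \<subseteq> W \<longrightarrow> \<not> cut_pair e f)"

text \<open>Let \<open>x\<close> be the end of \<open>e\<close> in \<open>W\<close> and
  \<open>X\<close> the side of the cut with edges \<open>e\<close> and \<open>f\<close> that misses
  \<open>x\<close>. The part of \<open>X\<close> in \<open>W\<close> is bounded by \<open>f\<close>
  and possibly \<open>e'\<close>, and not by \<open>f\<close> alone since \<open>f\<close> is no
  bridge.\<close>

lemma split_cut_side:
  assumes e: "nonbridge e" "e \<noteq> e'" and W: "bd W = {e, e'}" and f: "f \<in> E" "f \<subseteq> W" "cut_pair e f"
  obtains Y where "Y \<subset> W" "Y \<noteq> {}" "bd Y = {e', f}" "bd (W - Y) = {e, f}"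
proof -
  obtain x p where xp: "e = {x, p}" "x \<in> W" "p \<notin> W"
  proof -
    have "e \<in> E" using e by (simp add: nonbridge_def)
    then obtain a b where ab: "e = {a, b}" using edge_cases by blast
    have "(a \<in> W) \<noteq> (b \<in> W)" using W ab in_bd_iff[of a b W] by blast
    then show ?thesis using ab that[of a b] that[of b a] by (auto simp: insert_commute)
  qed
  have "\<exists>X. bd X = {e, f} \<and> x \<notin> X"
  proof -
    obtain X where "bd X = {e, f}" using f by (auto simp: cut_pair_def)
    then show ?thesis using bd_compl[of X] by (cases "x \<in> X") auto
  qed
  then obtain X where X: "bd X = {e, f}" "x \<notin> X" by blast
  define Y where "Y = W \<inter> X"
  have "f \<notin> bd W" using f(2) by (simp add: bd_def)
  then have fe: "f \<noteq> e" "f \<noteq> e'" using W by auto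
  have "bd Y \<subseteq> bd W \<union> bd X" by (auto simp: bd_def Y_def)
  then have "bd Y \<subseteq> {e, e', f}" using X(1) W by blast
  moreover have "e \<notin> bd Y" unfolding xp(1) in_bd_iff using xp X by (simp add: Y_def)
  moreover have fY: "f \<in> bd Y"
  proof -
    have "f \<in> bd X" using X by simp
    then show ?thesis using f(2) unfolding Y_def bd_def by blast
  qed
  moreover have "bd Y \<noteq> {f}" using nonbridge_cut_pair[OF e(1) f(3)] by (simp add: nonbridge_def)
  ultimately have bdY: "bd Y = {e', f}" by blast
  have "W - Y = W \<triangle> Y" by (auto simp: Y_def symdiff_def)
  moreover have "{e, e'} \<triangle> {e', f} = {e, f}" using fe e(2) unfolding symdiff_def by blast
  ultimately have "bd (W - Y) = {e, f}" using bdY W by (simp add: bd_symdiff)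
  moreover have "Y \<subset> W" using xp X by (auto simp: Y_def)
  moreover have "Y \<noteq> {}" using fY by (auto simp: bd_def)
  ultimately show ?thesis using that bdY by blast
qed

text \<open>Among the sides that contain \<open>T\<close> and are bounded by two edges of the class
  of \<open>f\<close>, one of least cardinality is solid: an edge of the class inside it would split
  it into two such sides, and by \<open>tight\<close> one of them contains \<open>T\<close>.\<close>

lemma solid_superset:
  assumes f: "nonbridge f" and X: "bd X = {f, f'}" "f \<noteq> f'" and T: "T \<subseteq> X" "T \<subseteq> V"
    and tight: "\<And>Y. bd Y \<subseteq> parallel f \<Longrightarrow> T \<subseteq> Y \<or> T \<inter> Y = {}"
  obtains W g g' where "T \<subseteq> W" "solid W g g'" "g \<in> parallel f"
proof -
  define P where "P W \<longleftrightarrow> W \<subseteq> V \<and> T \<subseteq> W \<and> (\<exists>g g'. g \<noteq> g' \<and> g \<in> parallel f \<and> g' \<in> parallel f \<and> bd W = {g, g'})" for W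
  have "f' \<in> parallel f" "f \<in> parallel f" using X(1) unfolding parallel_def cut_pair_def by blast+
  moreover have "bd (X \<inter> V) = {f, f'}" using X(1) bd_Int_V by simp
  ultimately have "P (X \<inter> V)" using X(2) T unfolding P_def by blast
  then obtain W where W: "P W" and min: "\<And>Y. P Y \<Longrightarrow> card W \<le> card Y"
    using ex_has_least_nat[of P "X \<inter> V" card] by blast
  obtain g g' where g: "g \<noteq> g'" "g \<in> parallel f" "g' \<in> parallel f" "bd W = {g, g'}" and WV: "W \<subseteq> V" "T \<subseteq> W"
    using W by (auto simp: P_def)
  have ng: "nonbridge g" using parallel_nonbridge f g by blast
  have "\<not> cut_pair g h" if h: "h \<in> E" "h \<subseteq> W" for h
  proof
    assume "cut_pair g h"
    from split_cut_side[OF ng g(1,4) h this]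
    obtain Y where Y: "Y \<subset> W" "Y \<noteq> {}" "bd Y = {g', h}" "bd (W - Y) = {g, h}" .
    have hp: "h \<in> parallel f"
      using parallel_trans[OF f g(2)] \<open>cut_pair g h\<close> by (simp add: parallel_def)
    have "h \<notin> bd W" using h by (simp add: bd_def)
    then have ne: "h \<noteq> g" "h \<noteq> g'" using g(4) by auto
    have fin: "finite W" using WV finite_V finite_subset by blast
    have "T \<subseteq> Y \<or> T \<inter> Y = {}" using tight Y(3) g(3) hp by simp
    then show False
    proof
      assume "T \<subseteq> Y"
      moreover have "Y \<subseteq> V" using Y(1) WV by blast
      ultimately have "P Y" unfolding P_def using Y(3) g(3) hp ne(2) by metis
      then show False using min[of Y] psubset_card_mono[OF fin Y(1)] by simp
    next
      assume "T \<inter> Y = {}"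
      then have "T \<subseteq> W - Y" "W - Y \<subseteq> V" using WV by blast+
      then have "P (W - Y)" unfolding P_def using Y(4) g(2) hp ne(1) by metis
      moreover have "W - Y \<subset> W" using Y(1,2) by blast
      ultimately show False using min[of "W - Y"] psubset_card_mono[OF fin, of "W - Y"] by simp
    qed
  qed
  then have "solid W g g'" using WV ng g by (simp add: solid_def)
  then show ?thesis using that WV g by blast
qed

text \<open>The part \<open>W \<inter> Y\<close> has its boundary among \<open>e\<close> and
  \<open>e'\<close>. A single edge would be a bridge, so the boundary is empty or all of
  \<open>bd W\<close>, and by connectedness \<open>W \<inter> Y\<close> or \<open>W - Y\<close> is
  empty.\<close>

lemma solid_tight:
  assumes W: "solid W e e'"
    and inside: "\<And>g. g \<in> E \<Longrightarrow> g \<subseteq> W \<Longrightarrow> g \<notin> parallel f" and Y: "bd Y \<subseteq> parallel f"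
  shows "W \<subseteq> Y \<or> W \<inter> Y = {}"
proof -
  have bdW: "bd W = {e, e'}" "e \<noteq> e'" "nonbridge e" "W \<subseteq> V" using W by (auto simp: solid_def)
  have "cut_pair e e'" using bdW by (auto simp: cut_pair_def)
  then have "nonbridge e'" using nonbridge_cut_pair bdW by blast
  have sub: "bd (W \<inter> Y) \<subseteq> {e, e'}"
  proof
    fix g assume g: "g \<in> bd (W \<inter> Y)"
    then have "g \<in> bd W \<or> (g \<subseteq> W \<and> g \<in> bd Y)" by (auto simp: bd_def)
    moreover have "g \<in> E" using g bd_subset by blast
    ultimately show "g \<in> {e, e'}" using bdW(1) inside[of g] Y by blast
  qed
  have diff: "W - Y = W \<triangle> (W \<inter> Y)" by (auto simp: symdiff_def)
  have "W \<noteq> V"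
  proof
    assume "W = V"
    then have "e \<subseteq> W" using edge_subset bdW(3) by (simp add: nonbridge_def)
    then have "e \<notin> bd W" by (simp add: bd_def)
    then show False using bdW by simp
  qed
  have nV: "\<not> V \<subseteq> Z" if "Z \<subseteq> W" for Z using \<open>W \<noteq> V\<close> that bdW(4) by blast
  consider "bd (W \<inter> Y) = {}" | "bd (W \<inter> Y) = {e}" | "bd (W \<inter> Y) = {e'}" | "bd (W \<inter> Y) = {e, e'}"
    using sub by blast
  then show ?thesis
  proof cases
    case 1
    then show ?thesis using bd_empty_cases[OF 1] nV[of "W \<inter> Y"] bdW(4) by blast
  next
    case 2 then show ?thesis using bdW by (simp add: nonbridge_def)
  next
    case 3 then show ?thesis using \<open>nonbridge e'\<close> by (simp add: nonbridge_def)
  next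
    case 4
    then have "bd (W - Y) = {}" unfolding diff bd_symdiff using bdW(1) by (simp add: symdiff_empty_iff)
    from bd_empty_cases[OF this] show ?thesis using nV[of "W - Y"] bdW(4) by blast
  qed
qed

end

section \<open>Two labels and more than one cycle\<close>

context connected_simple_graph
begin

text \<open>A labeling with two labels is encoded by the class of label 2, so that labelings can be
  changed by \<triangle>.\<close>

definition distinguishing_vertex_set :: "'a set \<Rightarrow> bool" where
  "distinguishing_vertex_set A \<longleftrightarrow>
     A \<subseteq> V \<and> (\<forall>\<beta>\<in>automorphisms V E. \<beta> ` A = A \<longrightarrow> (\<forall>x\<in>V. \<beta> x = x))"

definition distinguishing_edge_set :: "'a set set \<Rightarrow> bool" where
  "distinguishing_edge_set F \<longleftrightarrow>
     F \<subseteq> E \<and> (\<forall>\<beta>\<in>automorphisms V E. (`) \<beta> ` F = F \<longrightarrow> (\<forall>x\<in>V. \<beta> x = x))"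

lemma distinguishing_vertex_setD:
  assumes "distinguishing_vertex_set A" "\<beta> \<in> automorphisms V E" "\<beta> ` A = A" "x \<in> V"
  shows "\<beta> x = x"
  using assms by (simp add: distinguishing_vertex_set_def)

text \<open>A rearrangement by linearity. If \<open>F\<close> consists of one edge \<open>e\<close>
  that is moved, it exhibits \<open>e\<close> and its image as a two-edge cut.\<close>

lemma bd_image_symdiff:
  assumes \<beta>: "\<beta> \<in> automorphisms V E" and pres: "(`) \<beta> ` (bd A \<triangle> F) = bd A \<triangle> F"
  shows "bd (\<beta> ` A \<triangle> A) = ((`) \<beta> ` F) \<triangle> F"
proof -
  have eq: "((`) \<beta> ` bd A) \<triangle> ((`) \<beta> ` F) = bd A \<triangle> F"
    using pres image_symdiff[OF inj_image_set[OF aut_inj[OF \<beta>]]] by simp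
  show ?thesis unfolding bd_symdiff bd_image[OF \<beta>]
  proof (rule set_eqI)
    fix g
    have "g \<in> ((`) \<beta> ` bd A) \<triangle> ((`) \<beta> ` F) \<longleftrightarrow> g \<in> bd A \<triangle> F" using eq by simp
    then show "g \<in> ((`) \<beta> ` bd A) \<triangle> bd A \<longleftrightarrow> g \<in> ((`) \<beta> ` F) \<triangle> F"
      unfolding in_symdiff_iff by argo
  qed
qed

lemma same_bd_cases:
  assumes "bd (B \<triangle> A) = {}" "A \<subseteq> V" "B \<subseteq> V" shows "B = A \<or> B = V - A"
  using bd_empty_cases[OF assms(1)] assms(2,3) unfolding symdiff_def by blast

lemma aut_image_subset: "\<beta> \<in> automorphisms V E \<Longrightarrow> A \<subseteq> V \<Longrightarrow> \<beta> ` A \<subseteq> V"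
  using aut_image_V by blast

lemma bd_distinguishing:
  assumes A: "distinguishing_vertex_set A" and no: "\<And>\<alpha>. \<alpha> \<in> automorphisms V E \<Longrightarrow> \<alpha> ` A \<noteq> V - A"
  shows "distinguishing_edge_set (bd A)"
  unfolding distinguishing_edge_set_def
proof (intro conjI ballI impI)
  show "bd A \<subseteq> E" by (rule bd_subset)
  fix \<beta> x assume \<beta>: "\<beta> \<in> automorphisms V E" and pres: "(`) \<beta> ` bd A = bd A" and x: "x \<in> V"
  have "bd (\<beta> ` A \<triangle> A) = {}"
    unfolding bd_symdiff bd_image[OF \<beta>] pres by (simp add: symdiff_empty_iff)
  moreover have AV: "A \<subseteq> V" using A by (simp add: distinguishing_vertex_set_def)
  ultimately have "\<beta> ` A = A \<or> \<beta> ` A = V - A"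
    using same_bd_cases aut_image_subset[OF \<beta>] by blast
  then have "\<beta> ` A = A" using no[OF \<beta>] by blast
  then show "\<beta> x = x" by (rule distinguishing_vertex_setD[OF A \<beta> _ x])
qed

text \<open>An automorphism \<beta> that preserves the set fixes \<open>e\<close>, since otherwise
  \<open>e\<close> and its image would form a two-edge cut. If it exchanges \<open>A\<close> with
  its complement, then \<open>\<beta> \<circ> \<alpha>\<close> and
  \<open>\<alpha> \<circ> \<alpha>\<close> preserve \<open>A\<close> and are trivial, so \<beta>
  agrees with \<alpha>, which moves \<open>e\<close>.\<close>

lemma single_distinguishing:
  assumes A: "distinguishing_vertex_set A" and \<alpha>: "\<alpha> \<in> automorphisms V E" "\<alpha> ` A = V - A"
    and e: "single e" "\<alpha> ` e \<noteq> e"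
  shows "distinguishing_edge_set (bd A \<triangle> {e})"
  unfolding distinguishing_edge_set_def
proof (intro conjI ballI impI)
  have eE: "e \<in> E" using e by (simp add: single_def nonbridge_def)
  then show "bd A \<triangle> {e} \<subseteq> E" using bd_subset by (auto simp: symdiff_def)
  have AV: "A \<subseteq> V" using A by (simp add: distinguishing_vertex_set_def)
  have compl: "\<gamma> ` (V - A) = V - \<gamma> ` A" if "\<gamma> \<in> automorphisms V E" for \<gamma>
    by (simp add: image_set_diff[OF aut_inj[OF that]] aut_image_V[OF that])
  fix \<beta> x assume \<beta>: "\<beta> \<in> automorphisms V E" and pres: "(`) \<beta> ` (bd A \<triangle> {e}) = bd A \<triangle> {e}" and x: "x \<in> V"
  have bd: "bd (\<beta> ` A \<triangle> A) = {\<beta> ` e} \<triangle> {e}" using bd_image_symdiff[OF \<beta> pres] by simp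
  have \<beta>e: "\<beta> ` e = e"
  proof (rule ccontr)
    assume "\<beta> ` e \<noteq> e"
    then have "{\<beta> ` e} \<triangle> {e} = {e, \<beta> ` e}" unfolding symdiff_def by blast
    then have "cut_pair e (\<beta> ` e)" using bd unfolding cut_pair_def by metis
    then show False using e(1) by (simp add: single_def)
  qed
  then have "bd (\<beta> ` A \<triangle> A) = {}" using bd by (simp add: symdiff_empty_iff)
  then have "\<beta> ` A = A \<or> \<beta> ` A = V - A" using same_bd_cases AV aut_image_subset[OF \<beta>] by blast
  then show "\<beta> x = x"
  proof
    assume "\<beta> ` A = A"
    then show ?thesis by (rule distinguishing_vertex_setD[OF A \<beta> _ x])
  next
    assume "\<beta> ` A = V - A"
    have im: "(\<beta> \<circ> \<alpha>) ` A = A" "(\<alpha> \<circ> \<alpha>) ` A = A"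
      unfolding image_comp[symmetric] \<alpha>(2) compl[OF \<beta>] compl[OF \<alpha>(1)] \<open>\<beta> ` A = V - A\<close>
      using AV by blast+
    have "\<beta> y = \<alpha> y" if y: "y \<in> V" for y
    proof -
      have "\<alpha> (\<alpha> y) = y"
        using distinguishing_vertex_setD[OF A aut_comp[OF \<alpha>(1) \<alpha>(1)] im(2) y] by simp
      moreover have "\<alpha> y \<in> V" using y aut_in_V_iff[OF \<alpha>(1)] by simp
      then have "\<beta> (\<alpha> (\<alpha> y)) = \<alpha> y"
        using distinguishing_vertex_setD[OF A aut_comp[OF \<beta> \<alpha>(1)] im(1)] by simp
      ultimately show ?thesis by simp
    qed
    then have "\<alpha> ` e = \<beta> ` e" using edge_subset[OF eE] by (intro image_cong) auto
    then show ?thesis using \<beta>e e by simp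
  qed
qed

text \<open>As \<alpha> exchanges \<open>A\<close> and its complement, it fixes no vertex. Two edges
  that meet only in \<open>u\<close> cannot both be fixed, so one of them suits
  \<open>single_distinguishing\<close>.\<close>

lemma adjacent_singles_distinguishing:
  assumes A: "distinguishing_vertex_set A" and \<alpha>: "\<alpha> \<in> automorphisms V E" "\<alpha> ` A = V - A"
    and s: "single {u, w}" "single {u, z}" "z \<noteq> w"
  shows "\<exists>F. distinguishing_edge_set F"
proof -
  have "{u, w} \<in> E" using s by (simp add: single_def nonbridge_def)
  then have u: "u \<in> V" using edgeD by blast
  have "\<alpha> u \<noteq> u"
  proof
    assume "\<alpha> u = u"
    then show False using inj_image_mem_iff[OF aut_inj[OF \<alpha>(1)], of u A] \<alpha>(2) u by auto
  qed
  then have "\<alpha> ` {u, w} \<noteq> {u, w} \<or> \<alpha> ` {u, z} \<noteq> {u, z}"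
    using s(3) by (auto simp: doubleton_eq_iff)
  then show ?thesis using single_distinguishing[OF A \<alpha>] s by blast
qed

text \<open>The edge \<open>f\<close> is inside \<open>W\<close>, while all nonbridge edges away
  from \<open>W\<close> are parallel to \<open>e\<close>. So an automorphism that keeps
  \<open>e\<close> and \<open>e'\<close> in their class cannot move \<open>W\<close> off itself and
  hence preserves it. Different labels on \<open>e\<close> and \<open>e'\<close> then fix the ends
  of \<open>e\<close>, and a fixed vertex rules out an exchange of the two label classes.\<close>

lemma solid_distinguishing:
  assumes A: "distinguishing_vertex_set A" and W: "solid W e e'"
    and f: "nonbridge f" "f \<notin> parallel e"
    and outside: "\<And>g. nonbridge g \<Longrightarrow> g \<inter> W = {} \<Longrightarrow> g \<in> parallel e"
  shows "\<exists>F. distinguishing_edge_set F"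
proof -
  have bdW: "bd W = {e, e'}" "e \<noteq> e'" "nonbridge e" "W \<subseteq> V" using W by (auto simp: solid_def)
  have inside: "g \<notin> parallel e" if "g \<in> E" "g \<subseteq> W" for g
  proof -
    have "g \<notin> bd W" using that(2) by (simp add: bd_def)
    then show ?thesis using W bdW(1) that unfolding solid_def parallel_def by blast
  qed
  have e'p: "e' \<in> parallel e" by (rule parallelI[OF bdW(1)])
  have ends: "\<exists>x p. g = {x, p} \<and> x \<in> W \<and> p \<notin> W \<and> x \<in> V \<and> p \<in> V" if "g \<in> bd W" for g
  proof -
    have "g \<in> E" using that bd_subset by blast
    then obtain a b where ab: "g = {a, b}" "a \<in> V" "b \<in> V" using edge_cases by blast
    have "(a \<in> W) \<noteq> (b \<in> W)" using that ab in_bd_iff[of a b W] by blast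
    then show ?thesis using ab by (metis insert_commute)
  qed
  obtain x p where xp: "e = {x, p}" "x \<in> W" "p \<notin> W" "x \<in> V" "p \<in> V" using ends[of e] bdW by blast
  obtain y q where yq: "e' = {y, q}" "y \<in> W" "q \<notin> W" using ends[of e'] bdW by blast
  have EE: "{x, p} \<in> E" "{y, q} \<in> E" using bdW(1) bd_subset[of W] xp yq by auto
  have AV: "A \<subseteq> V" using A by (simp add: distinguishing_vertex_set_def)
  \<comment> \<open>Vertex labels at the ends of \<open>e\<close> are changed, if necessary, so that
    \<open>bd B\<close> contains both or neither of \<open>e\<close> and \<open>e'\<close>; toggling
    \<open>e\<close> then makes their labels differ. The change is harmless because the ends of
    \<open>e\<close> turn out to be fixed.\<close>
  have "\<exists>B. B \<subseteq> V \<and> A \<triangle> B \<subseteq> {x, p} \<and> (e \<in> bd B \<longleftrightarrow> e' \<in> bd B)"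
  proof (cases "e \<in> bd A \<longleftrightarrow> e' \<in> bd A")
    case True
    then show ?thesis using AV by (intro exI[of _ A]) (simp add: symdiff_def)
  next
    case False
    \<comment> \<open>An end of \<open>e\<close> that is not an end of \<open>e'\<close>: toggling
      it affects \<open>e\<close> but not \<open>e'\<close>.\<close>
    define t where "t = (if x = y then p else x)"
    have t: "t \<in> V" "t \<in> {x, p}" "t \<in> e" "t \<notin> e'"
      using xp yq bdW(2) by (auto simp: t_def)
    have "x \<noteq> p" using xp by blast
    then have "e \<in> bd {t}" unfolding xp(1) in_bd_iff using EE(1) by (auto simp: t_def)
    moreover have "e' \<notin> bd {t}" using t(4) by (simp add: bd_def)
    ultimately have "e \<in> bd (A \<triangle> {t}) \<longleftrightarrow> e' \<in> bd (A \<triangle> {t})"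
      using False by (simp add: bd_symdiff in_symdiff_iff)
    moreover have "A \<triangle> {t} \<subseteq> V" "A \<triangle> (A \<triangle> {t}) \<subseteq> {x, p}" using AV t unfolding symdiff_def by blast+
    ultimately show ?thesis by blast
  qed
  then obtain B where B: "B \<subseteq> V" "A \<triangle> B \<subseteq> {x, p}" "e \<in> bd B \<longleftrightarrow> e' \<in> bd B" by blast
  have "distinguishing_edge_set (bd B \<triangle> {e})"
    unfolding distinguishing_edge_set_def
  proof (intro conjI ballI impI)
    show "bd B \<triangle> {e} \<subseteq> E" using bd_subset EE(1) xp(1) by (auto simp: symdiff_def)
    fix \<beta> v assume \<beta>: "\<beta> \<in> automorphisms V E" and pres: "(`) \<beta> ` (bd B \<triangle> {e}) = bd B \<triangle> {e}" and v: "v \<in> V"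
    have bd: "bd (\<beta> ` B \<triangle> B) = {\<beta> ` e} \<triangle> {e}" using bd_image_symdiff[OF \<beta> pres] by simp
    have \<beta>e: "\<beta> ` e \<in> parallel e"
    proof (cases "\<beta> ` e = e")
      case False
      then have "{\<beta> ` e} \<triangle> {e} = {e, \<beta> ` e}" unfolding symdiff_def by blast
      then show ?thesis using bd by (intro parallelI) simp
    qed (simp add: parallel_def)
    have "\<beta> ` e' \<in> parallel (\<beta> ` e)" using parallel_image[OF \<beta>] e'p by simp
    then have \<beta>e': "\<beta> ` e' \<in> parallel e" using parallel_trans[OF bdW(3) \<beta>e] by blast
    have bd\<beta>W: "bd (\<beta> ` W) = {\<beta> ` e, \<beta> ` e'}" using bd_image[OF \<beta>, of W] bdW(1) by simp
    then have "W \<subseteq> \<beta> ` W \<or> W \<inter> \<beta> ` W = {}"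
      using solid_tight[OF W inside] \<beta>e \<beta>e' by simp
    moreover have "W \<inter> \<beta> ` W \<noteq> {}"
    proof
      assume disj: "W \<inter> \<beta> ` W = {}"
      have "f \<inter> W \<noteq> {}" using outside f by blast
      moreover have "f \<notin> bd W" using f(2) e'p bdW(1) by (auto simp: parallel_def)
      moreover have "f \<in> E" using f by (simp add: nonbridge_def)
      ultimately have "f \<subseteq> W" by (simp add: bd_def)
      then have "\<beta> ` f \<inter> W = {}" using disj by blast
      then have "\<beta> ` f \<in> parallel e" using outside nonbridge_image[OF \<beta>] f(1) by simp
      moreover have "e \<in> parallel (\<beta> ` e)" using \<beta>e by (rule parallel_sym)
      moreover have "nonbridge (\<beta> ` e)" using nonbridge_image[OF \<beta>] bdW(3) by simp
      ultimately have "\<beta> ` f \<in> parallel (\<beta> ` e)" using parallel_trans by blast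
      then show False using f(2) parallel_image[OF \<beta>] by simp
    qed
    ultimately have "W \<subseteq> \<beta> ` W" by blast
    moreover have "card (\<beta> ` W) = card W" using aut_inj[OF \<beta>] by (simp add: card_image inj_on_subset)
    moreover have "finite (\<beta> ` W)" using bdW(4) finite_V finite_subset by blast
    ultimately have \<beta>W: "\<beta> ` W = W" by (metis card_subset_eq)
    then have ee': "{\<beta> ` e, \<beta> ` e'} = {e, e'}" using bd\<beta>W bdW(1) by simp
    have "g \<in> bd B \<triangle> {e} \<longleftrightarrow> \<beta> ` g \<in> bd B \<triangle> {e}" for g
      using pres inj_image_mem_iff[OF inj_image_set[OF aut_inj[OF \<beta>]], of g "bd B \<triangle> {e}"] by simp
    moreover have "e \<in> bd B \<triangle> {e} \<longleftrightarrow> e' \<notin> bd B \<triangle> {e}"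
      using B(3) bdW(2) by (simp add: in_symdiff_iff)
    ultimately have fix_e: "\<beta> ` e = e" using ee' by (metis doubleton_eq_iff)
    have "\<beta> x \<in> W" using \<beta>W xp by blast
    moreover have "{\<beta> x, \<beta> p} = {x, p}" using fix_e xp by simp
    ultimately have fixed: "\<beta> x = x" "\<beta> p = p" using xp by (auto simp: doubleton_eq_iff)
    have "bd (\<beta> ` B \<triangle> B) = {}" using bd fix_e by (simp add: symdiff_empty_iff)
    then have "\<beta> ` B = B \<or> \<beta> ` B = V - B" using same_bd_cases B(1) aut_image_subset[OF \<beta>] by blast
    moreover have "x \<in> \<beta> ` B \<longleftrightarrow> x \<in> B"
      using inj_image_mem_iff[OF aut_inj[OF \<beta>], of x B] fixed by simp
    ultimately have "\<beta> ` B = B" using xp by blast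
    moreover have "\<beta> ` (A \<triangle> B) = A \<triangle> B"
    proof -
      have "\<beta> t = t" if "t \<in> A \<triangle> B" for t using that B(2) fixed by blast
      then show ?thesis by simp
    qed
    ultimately have "\<beta> ` A \<triangle> B = A \<triangle> B" using image_symdiff[OF aut_inj[OF \<beta>], of A B] by simp
    then have "\<beta> ` A = A" unfolding set_eq_iff in_symdiff_iff by blast
    then show "\<beta> v = v" by (rule distinguishing_vertex_setD[OF A \<beta> _ v])
  qed
  then show ?thesis by blast
qed

text \<open>No edge inside \<open>W\<close> is parallel to \<open>f\<close>, so a two-edge cut
  through \<open>f\<close> would have all of \<open>W\<close> on one side. That side would yield a
  solid set \<open>Z\<close> around \<open>W\<close> bounded by edges parallel to \<open>f\<close>.
  By maximality \<open>Z\<close> equals \<open>W\<close>, which makes \<open>f\<close> parallel to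
  \<open>e\<close>.\<close>

lemma outside_maximal_solid_single:
  assumes W: "solid W e e'" and max: "\<And>X g g'. solid X g g' \<Longrightarrow> card X \<le> card W"
    and f: "nonbridge f" "f \<inter> W = {}" "f \<notin> parallel e"
  shows "single f"
proof -
  have bdW: "bd W = {e, e'}" "e \<noteq> e'" "nonbridge e" "W \<subseteq> V" using W by (auto simp: solid_def)
  have e'p: "e' \<in> parallel e" by (rule parallelI[OF bdW(1)])
  have ef: "g \<notin> parallel e" if "g \<in> parallel f" for g
    using parallel_trans[OF bdW(3)] parallel_sym[OF that] f(3) by blast
  \<comment> \<open>Intersecting a side of the cut with edges \<open>f\<close> and \<open>g\<close>
    with \<open>W\<close> removes \<open>f\<close> from the boundary. In each of the remaining cases
    \<open>g\<close> is a bridge or parallel to \<open>e\<close>.\<close>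
  have inside: "g \<notin> parallel f" if g: "g \<in> E" "g \<subseteq> W" for g
  proof
    assume gf: "g \<in> parallel f"
    then have ng: "nonbridge g" using parallel_nonbridge f by blast
    have "f \<noteq> {}" using f(1) edge_cases by (metis insert_not_empty nonbridge_def)
    then have "g \<noteq> f" using f(2) g(2) by blast
    then obtain X where X: "bd X = {f, g}" using gf by (auto simp: parallel_def cut_pair_def)
    have gX: "g \<in> bd (X \<inter> W)"
    proof -
      have "g \<in> bd X" using X by simp
      then show ?thesis using g(2) unfolding bd_def by blast
    qed
    have "f \<notin> bd (X \<inter> W)" using f(2) by (auto simp: bd_def)
    moreover have "bd (X \<inter> W) \<subseteq> bd X \<union> bd W" by (auto simp: bd_def)
    ultimately have "bd (X \<inter> W) \<subseteq> {g, e, e'}" using X bdW(1) by auto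
    then consider "bd (X \<inter> W) = {g}" | "bd (X \<inter> W) = {g, e}" | "bd (X \<inter> W) = {g, e'}"
      | "bd (X \<inter> W) = {g, e, e'}" using gX by blast
    then show False
    proof cases
      case 1
      then show False using ng by (simp add: nonbridge_def)
    next
      case 2
      then have "e \<in> parallel g" by (rule parallelI)
      then show False using ef[OF gf] parallel_sym by blast
    next
      case 3
      then have "e' \<in> parallel g" by (rule parallelI)
      then have "g \<in> parallel e'" by (rule parallel_sym)
      then show False using ef[OF gf] parallel_trans[OF bdW(3) e'p] by blast
    next
      case 4
      have "g \<notin> bd W" using g(2) by (simp add: bd_def)
      then have "{e, e'} \<triangle> {g, e, e'} = {g}" unfolding symdiff_def bdW(1) by blast
      then have "bd (W \<triangle> (X \<inter> W)) = {g}" using 4 bdW(1) by (simp add: bd_symdiff)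
      then show False using ng by (simp add: nonbridge_def)
    qed
  qed
  have "\<not> cut_pair f f'" for f'
  proof
    assume c: "cut_pair f f'"
    then obtain X where X: "bd X = {f, f'}" by (auto simp: cut_pair_def)
    have "f \<noteq> f'" using nonbridge_cut_pair f(1) c by blast
    have "bd X \<subseteq> parallel f" using X c by (auto simp: parallel_def)
    from solid_tight[OF W inside this]
    have "W \<subseteq> X \<or> W \<subseteq> - X" by blast
    then obtain Y where Y: "bd Y = {f, f'}" "W \<subseteq> Y" using X bd_compl[of X] by metis
    obtain Z g g' where Z: "W \<subseteq> Z" "solid Z g g'" "g \<in> parallel f"
      using solid_superset[OF f(1) Y(1) \<open>f \<noteq> f'\<close> Y(2) bdW(4)] solid_tight[OF W inside] by metis
    have "Z \<subseteq> V" using Z(2) by (simp add: solid_def)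
    then have "finite Z" by (rule finite_subset[OF _ finite_V])
    then have "Z = W" using card_seteq[OF _ Z(1) max[OF Z(2)]] by simp
    then have "{g, g'} = {e, e'}" using Z(2) bdW(1) by (simp add: solid_def)
    then have "g \<in> parallel e" using e'p by (auto simp: parallel_def doubleton_eq_iff)
    then show False using ef Z(3) by blast
  qed
  then show ?thesis using f by (simp add: single_def)
qed

text \<open>Two classes mean more than one cycle. If all nonbridge edges are \<open>single\<close>,
  two adjacent ones suffice. Otherwise let \<open>W\<close> be a solid set of greatest cardinality:
  a nonbridge edge away from \<open>W\<close> and outside the class of \<open>e\<close> leads to two
  adjacent \<open>single\<close> edges, and without such an edge \<open>solid_distinguishing\<close>
  applies.\<close>

lemma distinguishing_edge_set_if_two_classes:
  assumes A: "distinguishing_vertex_set A" and c: "nonbridge c" and f: "nonbridge f" "f \<notin> parallel c"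
  shows "\<exists>F. distinguishing_edge_set F"
proof (cases "\<exists>\<alpha>\<in>automorphisms V E. \<alpha> ` A = V - A")
  case False
  then show ?thesis using bd_distinguishing[OF A] by blast
next
  case True
  then obtain \<alpha> where \<alpha>: "\<alpha> \<in> automorphisms V E" "\<alpha> ` A = V - A" by blast
  show ?thesis
  proof (cases "\<forall>g. nonbridge g \<longrightarrow> single g")
    case True
    obtain u w where uw: "c = {u, w}" "{u, w} \<in> E" using c edge_cases by (metis nonbridge_def)
    \<comment> \<open>The empty set is not an edge; taking it as the edge to be avoided reduces
      \<open>adjacent_nonbridge\<close> to a statement about nonbridge edges.\<close>
    have "\<not> cut_pair {} c"
    proof
      assume "cut_pair {} c"
      then obtain X where "bd X = {{}, c}" by (auto simp: cut_pair_def)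
      then have "{} \<in> E" using bd_subset[of X] by simp
      then show False using edge_cases by blast
    qed
    then obtain z where "z \<noteq> w" "nonbridge {u, z}"
      using adjacent_nonbridge[of u w "{}"] uw c by auto
    then show ?thesis using adjacent_singles_distinguishing[OF A \<alpha>, of u w z] True c uw by blast
  next
    case False
    then obtain g g' where g: "nonbridge g" "cut_pair g g'" by (auto simp: single_def)
    then have "g \<noteq> g'" using nonbridge_cut_pair by blast
    obtain X where X: "bd X = {g, g'}" using g by (auto simp: cut_pair_def)
    define P where "P W \<longleftrightarrow> (\<exists>e e'. solid W e e')" for W
    \<comment> \<open>With empty \<open>T\<close> the tightness is trivial; only the existence of a
      solid set is wanted.\<close>
    obtain W0 h h' where "solid W0 h h'"
      by (rule solid_superset[OF g(1) X \<open>g \<noteq> g'\<close>, of "{}"]) auto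
    then have "P W0" by (auto simp: P_def)
    moreover have "\<forall>W. P W \<longrightarrow> card W < Suc (card V)"
      using card_mono[OF finite_V] by (auto simp: P_def solid_def less_Suc_eq_le)
    ultimately obtain W where PW: "P W" and Pmax: "\<And>X. P X \<Longrightarrow> card X \<le> card W"
      using ex_has_greatest_nat[of P W0 card "Suc (card V)"] by blast
    obtain e e' where W: "solid W e e'" using PW by (auto simp: P_def)
    have max: "card X \<le> card W" if "solid X g g'" for X g g'
      using Pmax that by (auto simp: P_def)
    have bdW: "bd W = {e, e'}" "nonbridge e" using W by (auto simp: solid_def)
    show ?thesis
    proof (cases "\<exists>h. nonbridge h \<and> h \<inter> W = {} \<and> h \<notin> parallel e")
      case True
      then obtain h where h: "nonbridge h" "h \<inter> W = {}" "h \<notin> parallel e" by blast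
      obtain u w where uw: "h = {u, w}" "{u, w} \<in> E" using h edge_cases by (metis nonbridge_def)
      have "\<not> cut_pair e {u, w}" "{u, w} \<noteq> e" using h uw by (auto simp: parallel_def)
      then obtain z where z: "z \<noteq> w" "{u, z} \<noteq> e" "nonbridge {u, z}" "\<not> cut_pair e {u, z}"
        using adjacent_nonbridge[of u w e] uw h by blast
      have "{u, z} \<notin> parallel e" using z by (simp add: parallel_def)
      moreover have "e' \<in> parallel e" by (rule parallelI[OF bdW(1)])
      ultimately have "{u, z} \<notin> bd W" using bdW(1) z(2) by auto
      moreover have "{u, z} \<in> E" using z by (simp add: nonbridge_def)
      ultimately have "{u, z} \<inter> W = {}" using h(2) uw(1) by (auto simp: in_bd_iff)
      then have "single {u, z}"
        using outside_maximal_solid_single[OF W _ z(3)] max \<open>{u, z} \<notin> parallel e\<close> by simp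
      moreover have "single {u, w}" using outside_maximal_solid_single[OF W _ h] max uw(1) by simp
      ultimately show ?thesis using z(1) by (intro adjacent_singles_distinguishing[OF A \<alpha>])
    next
      case False
      have "\<exists>h. nonbridge h \<and> h \<notin> parallel e"
      proof (cases "c \<in> parallel e")
        case True
        then have "f \<notin> parallel e"
          using parallel_trans[OF c, of e f] parallel_sym f(2) by blast
        then show ?thesis using f(1) by blast
      qed (use c in blast)
      then obtain h where "nonbridge h" "h \<notin> parallel e" by blast
      then show ?thesis by (rule solid_distinguishing[OF A W]) (use False in blast)
    qed
  qed
qed

end

section \<open>Breadth-first labelings\<close>

context connected_simple_graph
begin

text \<open>The breadth-first layer, that is, the distance of \<open>v\<close> from
  \<open>S\<close>.\<close>

definition layer :: "'a set \<Rightarrow> 'a \<Rightarrow> nat" where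
  "layer S v = (LEAST n. \<exists>s\<in>S. (s, v) \<in> adj_rel E ^^ n)"

definition parent :: "'a set \<Rightarrow> 'a \<Rightarrow> 'a" where
  "parent S v = (SOME u. {v, u} \<in> E \<and> Suc (layer S u) = layer S v)"

text \<open>A parent edge carries the label of its end farther from \<open>S\<close>. The use of
  \<open>THE\<close> is justified by \<open>tree_edge_unique\<close>: no edge is the parent edge of
  both its ends.\<close>

definition tree_labeling :: "'a set \<Rightarrow> ('a \<Rightarrow> nat) \<Rightarrow> ('a set \<Rightarrow> nat) \<Rightarrow> nat \<Rightarrow> 'a set \<Rightarrow> nat" where
  "tree_labeling S \<phi> p r e =
     (if e \<subseteq> S then p e
      else if \<exists>v\<in>V - S. e = {v, parent S v} then \<phi> (THE v. v \<in> V - S \<and> e = {v, parent S v})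
      else r)"

lemma relpow_image_iff:
  assumes \<beta>: "\<beta> \<in> automorphisms V E"
  shows "(\<beta> s, \<beta> v) \<in> adj_rel E ^^ n \<longleftrightarrow> (s, v) \<in> adj_rel E ^^ n"
proof (induction n arbitrary: v)
  case 0
  then show ?case using aut_inj[OF \<beta>] by (simp add: inj_eq)
next
  case (Suc n)
  have adj: "(\<beta> x, \<beta> v) \<in> adj_rel E \<longleftrightarrow> (x, v) \<in> adj_rel E" for x
    by (simp add: adj_rel_def aut_edge_iff[OF \<beta>])
  have surj: "\<exists>x. y = \<beta> x" for y using aut_bij[OF \<beta>] by (metis bij_pointE)
  have "(\<beta> s, \<beta> v) \<in> adj_rel E ^^ Suc n \<longleftrightarrow> (\<exists>y. (\<beta> s, y) \<in> adj_rel E ^^ n \<and> (y, \<beta> v) \<in> adj_rel E)"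
    by auto
  also have "\<dots> \<longleftrightarrow> (\<exists>x. (\<beta> s, \<beta> x) \<in> adj_rel E ^^ n \<and> (\<beta> x, \<beta> v) \<in> adj_rel E)"
    using surj by metis
  also have "\<dots> \<longleftrightarrow> (\<exists>x. (s, x) \<in> adj_rel E ^^ n \<and> (x, v) \<in> adj_rel E)"
    by (simp add: Suc.IH adj)
  also have "\<dots> \<longleftrightarrow> (s, v) \<in> adj_rel E ^^ Suc n" by auto
  finally show ?case .
qed

lemma layer_image:
  assumes \<beta>: "\<beta> \<in> automorphisms V E" and S: "\<beta> ` S = S"
  shows "layer S (\<beta> v) = layer S v"
proof -
  have "(\<exists>s\<in>S. (s, \<beta> v) \<in> adj_rel E ^^ n) \<longleftrightarrow> (\<exists>s\<in>\<beta> ` S. (s, \<beta> v) \<in> adj_rel E ^^ n)" for n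
    by (simp only: S)
  then have "(\<exists>s\<in>S. (s, \<beta> v) \<in> adj_rel E ^^ n) \<longleftrightarrow> (\<exists>s\<in>S. (s, v) \<in> adj_rel E ^^ n)" for n
    by (simp add: relpow_image_iff[OF \<beta>])
  then show ?thesis by (simp add: layer_def)
qed

context
  fixes S :: "'a set"
  assumes SV: "S \<subseteq> V" and Sne: "S \<noteq> {}"
begin

lemma layer_attained: assumes "v \<in> V" shows "\<exists>s\<in>S. (s, v) \<in> adj_rel E ^^ layer S v"
proof -
  obtain s where "s \<in> S" using Sne by blast
  then have "(s, v) \<in> (adj_rel E)\<^sup>*" using conn SV assms by (auto simp: connected_graph_def)
  then obtain n where "(s, v) \<in> adj_rel E ^^ n" using rtrancl_imp_relpow by blast
  then have "\<exists>s\<in>S. (s, v) \<in> adj_rel E ^^ n" using \<open>s \<in> S\<close> by blast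
  then show ?thesis unfolding layer_def by (rule LeastI)
qed

lemma layer_le: "s \<in> S \<Longrightarrow> (s, v) \<in> adj_rel E ^^ n \<Longrightarrow> layer S v \<le> n"
  unfolding layer_def by (rule Least_le) blast

lemma layer_0_iff: assumes "v \<in> V" shows "layer S v = 0 \<longleftrightarrow> v \<in> S"
  using layer_attained[OF assms] layer_le[of v v 0] by auto

lemma layer_edge_le: assumes "{u, v} \<in> E" shows "layer S v \<le> Suc (layer S u)"
proof -
  have "u \<in> V" using assms edgeD by blast
  then obtain s where "s \<in> S" "(s, u) \<in> adj_rel E ^^ layer S u" using layer_attained by blast
  moreover have "(u, v) \<in> adj_rel E" using assms by (simp add: adj_rel_def)
  ultimately show ?thesis using layer_le[of s v "Suc (layer S u)"] by auto
qed

lemma parent_props: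
  assumes v: "v \<in> V - S" shows "{v, parent S v} \<in> E" "Suc (layer S (parent S v)) = layer S v"
proof -
  have "layer S v \<noteq> 0" using layer_0_iff v by blast
  then obtain n where n: "layer S v = Suc n" by (cases "layer S v") auto
  obtain s where s: "s \<in> S" "(s, v) \<in> adj_rel E ^^ Suc n" using layer_attained[of v] v n by auto
  then obtain u where u: "(s, u) \<in> adj_rel E ^^ n" "(u, v) \<in> adj_rel E" by auto
  have uv: "{u, v} \<in> E" using u by (simp add: adj_rel_def)
  have "layer S u \<le> n" using layer_le s u by blast
  then have "Suc (layer S u) = layer S v" using layer_edge_le[OF uv] n by simp
  moreover have "{v, u} \<in> E" using uv by (simp add: insert_commute)
  ultimately have "\<exists>u. {v, u} \<in> E \<and> Suc (layer S u) = layer S v" by blast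
  from someI_ex[OF this] show "{v, parent S v} \<in> E" "Suc (layer S (parent S v)) = layer S v"
    unfolding parent_def by auto
qed

lemma parent_in_V: "v \<in> V - S \<Longrightarrow> parent S v \<in> V"
  using parent_props edgeD by blast

lemma tree_edge_unique:
  assumes "v \<in> V - S" "w \<in> V - S" "{v, parent S v} = {w, parent S w}" shows "v = w"
proof (rule ccontr)
  assume "v \<noteq> w"
  then have "parent S v = w" "parent S w = v" using assms(3) by (auto simp: doubleton_eq_iff)
  then show False using parent_props(2)[OF assms(1)] parent_props(2)[OF assms(2)] by simp
qed

lemma tree_labeling_tree:
  assumes v: "v \<in> V - S" shows "tree_labeling S \<phi> p r {v, parent S v} = \<phi> v"
proof -
  have "(THE w. w \<in> V - S \<and> {v, parent S v} = {w, parent S w}) = v"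
    by (rule the_equality) (use v tree_edge_unique in auto)
  moreover have "\<not> {v, parent S v} \<subseteq> S" "\<exists>w\<in>V - S. {v, parent S v} = {w, parent S w}" using v by auto
  ultimately show ?thesis unfolding tree_labeling_def by (simp only: if_True if_False)
qed

text \<open>The edge could only be the parent edge of \<open>u\<close>, but then \<open>v\<close>
  would be in a smaller layer than \<open>u\<close>.\<close>

lemma tree_labeling_down:
  assumes "{v, u} \<in> E" "v \<notin> S" "layer S u \<le> layer S v" "u \<noteq> parent S v"
  shows "tree_labeling S \<phi> p r {v, u} = r"
proof -
  have "{v, u} \<noteq> {w, parent S w}" if w: "w \<in> V - S" for w
  proof
    assume eq: "{v, u} = {w, parent S w}"
    have "w \<noteq> v" using eq assms(4) by (auto simp: doubleton_eq_iff)
    then have "w = u" "parent S w = v" using eq by (auto simp: doubleton_eq_iff)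
    then show False using parent_props(2)[OF w] assms(3) by simp
  qed
  then show ?thesis using assms(2) unfolding tree_labeling_def by auto
qed

lemma tree_labeling_range:
  assumes "\<And>e. e \<in> E \<Longrightarrow> e \<subseteq> S \<Longrightarrow> p e \<in> {1..r}" "\<And>v. v \<in> V \<Longrightarrow> \<phi> v \<in> {1..r}" "1 \<le> r" "e \<in> E"
  shows "tree_labeling S \<phi> p r e \<in> {1..r}"
proof (cases "\<not> e \<subseteq> S \<and> (\<exists>v\<in>V - S. e = {v, parent S v})")
  case True
  then show ?thesis using tree_labeling_tree assms(2) by auto
next
  case False
  then show ?thesis using assms(1)[OF assms(4)] assms(3) by (auto simp: tree_labeling_def)
qed

text \<open>An automorphism fixing \<^term>\<open>S\<close> need not preserve the tree. But the labels on the edges from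
  \<^term>\<open>v\<close> to the previous layer are \<^term>\<open>\<phi> v\<close> once and \<^term>\<open>r\<close> otherwise, which determines \<^term>\<open>\<phi> v\<close>.\<close>

lemma tree_labeling_decode:
  assumes \<beta>: "\<beta> \<in> automorphisms V E" and \<beta>S: "\<beta> ` S = S"
    and pres: "\<And>e. e \<in> E \<Longrightarrow> tree_labeling S \<phi> p r (\<beta> ` e) = tree_labeling S \<phi> p r e"
    and v: "v \<in> V - S"
  shows "\<phi> (\<beta> v) = \<phi> v"
proof -
  let ?\<psi> = "tree_labeling S \<phi> p r"
  have \<beta>v: "\<beta> v \<in> V - S"
    using v aut_in_V_iff[OF \<beta>] inj_image_mem_iff[OF aut_inj[OF \<beta>], of v S] \<beta>S by simp
  \<comment> \<open>As \<beta> preserves layers, \<open>u\<close> is a neighbour of \<open>v\<close>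
    in the layer before \<open>v\<close>.\<close>
  obtain u where u: "parent S (\<beta> v) = \<beta> u" using aut_bij[OF \<beta>] by (metis bij_pointE)
  have uE: "{v, u} \<in> E" using parent_props(1)[OF \<beta>v] u aut_edge_iff[OF \<beta>] by simp
  have "layer S u \<le> layer S v"
    using parent_props(2)[OF \<beta>v] u layer_image[OF \<beta> \<beta>S] by simp
  then have "?\<psi> {v, u} \<in> {\<phi> v, r}"
    using tree_labeling_down[OF uE, of \<phi> p r] tree_labeling_tree[OF v, of \<phi> p r] v by (cases "u = parent S v") auto
  moreover have "?\<psi> {v, u} = \<phi> (\<beta> v)"
    using pres[OF uE] tree_labeling_tree[OF \<beta>v, of \<phi> p r] u by simp
  ultimately have 1: "\<phi> (\<beta> v) \<in> {\<phi> v, r}" by simp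
  let ?w = "parent S v"
  have wE: "{\<beta> v, \<beta> ?w} \<in> E" using parent_props(1)[OF v] aut_edge_iff[OF \<beta>] by simp
  have "layer S (\<beta> ?w) \<le> layer S (\<beta> v)"
    using parent_props(2)[OF v] layer_image[OF \<beta> \<beta>S] by simp
  then have "?\<psi> {\<beta> v, \<beta> ?w} \<in> {\<phi> (\<beta> v), r}"
    using tree_labeling_down[OF wE, of \<phi> p r] tree_labeling_tree[OF \<beta>v, of \<phi> p r] \<beta>v
    by (cases "\<beta> ?w = parent S (\<beta> v)") auto
  moreover have "?\<psi> {\<beta> v, \<beta> ?w} = \<phi> v"
    using pres[OF parent_props(1)[OF v]] tree_labeling_tree[OF v, of \<phi> p r] by simp
  \<comment> \<open>Each of the two labels equals the other one or \<open>r\<close>, so they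
    agree.\<close>
  ultimately show ?thesis using 1 by auto
qed

end

text \<open>The edges with a label other than \<^term>\<open>r\<close> form \<^term>\<open>F\<close> together with a forest hanging off it, so
  \<^term>\<open>F\<close> is their 2-core.\<close>

lemma core_preserved:
  assumes F: "F \<subseteq> E" "F \<noteq> {}" and two: "\<And>v. v \<in> \<Union>F \<Longrightarrow> \<exists>f\<in>F. \<exists>g\<in>F. f \<noteq> g \<and> v \<in> f \<and> v \<in> g"
    and p: "\<And>e. e \<in> F \<Longrightarrow> p e \<noteq> r" "\<And>e. e \<notin> F \<Longrightarrow> p e = r"
    and \<beta>: "\<beta> \<in> automorphisms V E"
    and pres: "\<And>e. e \<in> E \<Longrightarrow> tree_labeling (\<Union>F) \<phi> p r (\<beta> ` e) = tree_labeling (\<Union>F) \<phi> p r e"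
  shows "(`) \<beta> ` F = F"
proof -
  let ?S = "\<Union>F" let ?\<psi> = "tree_labeling (\<Union>F) \<phi> p r" let ?G = "(`) \<beta> ` F"
  have SV: "?S \<subseteq> V" using F edge_subset by blast
  have Sne: "?S \<noteq> {}" using F edge_cases by blast
  have inj: "inj ((`) \<beta>)" by (rule inj_image_set[OF aut_inj[OF \<beta>]])
  have GE: "?G \<subseteq> E" using F aut_image_edge[OF \<beta>] by blast
  have G\<psi>: "?\<psi> g \<noteq> r" if g: "g \<in> ?G" for g
  proof -
    obtain f where f: "f \<in> F" "g = \<beta> ` f" using g by blast
    then have "?\<psi> f = p f" unfolding tree_labeling_def by auto
    then show ?thesis using pres[of f] f F(1) p(1)[of f] by auto
  qed
  have two\<beta>: "\<exists>f\<in>?G. \<exists>g\<in>?G. f \<noteq> g \<and> v \<in> f \<and> v \<in> g" if v: "v \<in> \<Union>?G" for v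
  proof -
    obtain x where x: "x \<in> \<Union>F" "v = \<beta> x" using v by auto
    then obtain f g where "f \<in> F" "g \<in> F" "f \<noteq> g" "x \<in> f" "x \<in> g" using two by blast
    moreover then have "\<beta> ` f \<noteq> \<beta> ` g" using aut_inj[OF \<beta>] by (simp add: inj_image_eq_iff)
    ultimately show ?thesis using x(2) by blast
  qed
  have GV: "\<Union>?G \<subseteq> V" using GE edge_subset by blast
  then have fin: "finite (\<Union>?G)" using finite_V finite_subset by blast
  have "\<Union>?G \<noteq> {}" using F Sne by auto
  \<comment> \<open>A vertex \<open>m\<close> of \<open>?G\<close> farthest from \<open>?S\<close>
    is considered. Outside \<open>?S\<close>, every edge of \<open>?G\<close> at \<open>m\<close>
    other than the parent edge would have label \<open>r\<close>, so \<open>m\<close> would be on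
    only one edge of \<open>?G\<close>.\<close>
  then have "Max (layer ?S ` \<Union>?G) \<in> layer ?S ` \<Union>?G" using fin by (intro Max_in) auto
  then obtain m where m: "m \<in> \<Union>?G" "Max (layer ?S ` \<Union>?G) = layer ?S m" by blast
  have max: "layer ?S v \<le> layer ?S m" if "v \<in> \<Union>?G" for v
    unfolding m(2)[symmetric] using fin that by (intro Max_ge) auto
  have "m \<in> ?S"
  proof (rule ccontr)
    assume mS: "m \<notin> ?S"
    then have mV: "m \<in> V - ?S" using m GV by blast
    have only: "g = {m, parent ?S m}" if g: "g \<in> ?G" "m \<in> g" for g
    proof (rule ccontr)
      assume ne: "g \<noteq> {m, parent ?S m}"
      have gE: "g \<in> E" using g GE by blast
      then obtain u where u: "g = {m, u}" using g(2) edge_cases by (metis insert_commute insertE singletonD)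
      have "u \<in> \<Union>?G" using g u by blast
      then have "layer ?S u \<le> layer ?S m" by (rule max)
      moreover have "{m, u} \<in> E" "u \<noteq> parent ?S m" using gE ne u by auto
      ultimately have "?\<psi> {m, u} = r" using mS by (intro tree_labeling_down[OF SV Sne])
      then show False using G\<psi>[OF g(1)] u by simp
    qed
    obtain f g where "f \<in> ?G" "g \<in> ?G" "f \<noteq> g" "m \<in> f" "m \<in> g" using two\<beta>[OF m(1)] by blast
    then show False using only by metis
  qed
  then have "layer ?S v = 0" if "v \<in> \<Union>?G" for v
    using max[OF that] layer_0_iff[OF SV Sne, of m] SV by auto
  then have GS: "\<Union>?G \<subseteq> ?S" using layer_0_iff[OF SV Sne] GV by blast
  have "?G \<subseteq> F"
  proof
    fix g assume g: "g \<in> ?G"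
    then have "g \<subseteq> ?S" using GS by blast
    then have "?\<psi> g = p g" by (simp add: tree_labeling_def)
    then show "g \<in> F" using G\<psi>[OF g] p(2)[of g] by auto
  qed
  moreover have "card ?G = card F" using inj by (simp add: card_image inj_on_subset)
  moreover have "finite F" using F finite_E finite_subset by blast
  ultimately show ?thesis by (simp add: card_subset_eq)
qed

end

section \<open>Cycles and double lassos\<close>

text \<open>The vertices are \<open>v 0\<close> to \<open>v N\<close>, so the length of the cycle is
  \<open>N + 1\<close>.\<close>

definition cycle_edges :: "(nat \<Rightarrow> 'a) \<Rightarrow> nat \<Rightarrow> 'a set set" where
  "cycle_edges v N = insert {v N, v 0} (walk_edges v 0 N)"

lemma walk_edge_eq_iff:
  assumes "inj_on v {a..b}" "a \<le> s" "s < b" "a \<le> t" "t < b"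
  shows "{v s, v (Suc s)} = {v t, v (Suc t)} \<longleftrightarrow> s = t"
proof
  have "s \<in> {a..b}" "Suc s \<in> {a..b}" "t \<in> {a..b}" "Suc t \<in> {a..b}" using assms by auto
  moreover assume "{v s, v (Suc s)} = {v t, v (Suc t)}"
  ultimately have "(s = t \<and> Suc s = Suc t) \<or> (s = Suc t \<and> Suc s = t)"
    using inj_onD[OF assms(1)] by (metis doubleton_eq_iff)
  then show "s = t" by auto
qed simp

lemma closing_edge_neq:
  assumes "inj_on v {0..N}" "2 \<le> i" "i \<le> N" "t < N"
  shows "{v 0, v i} \<noteq> {v t, v (Suc t)}"
proof
  have "0 \<in> {0..N}" "i \<in> {0..N}" "t \<in> {0..N}" "Suc t \<in> {0..N}" using assms by auto
  moreover assume "{v 0, v i} = {v t, v (Suc t)}"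
  ultimately have "(0 = t \<and> i = Suc t) \<or> (0 = Suc t \<and> i = t)"
    using inj_onD[OF assms(1)] by (metis doubleton_eq_iff)
  then show False using assms by auto
qed

lemma Union_walk_edges:
  assumes "a < b" shows "\<Union>(walk_edges v a b) = v ` {a..b}"
proof
  show "\<Union>(walk_edges v a b) \<subseteq> v ` {a..b}" by (auto simp: walk_edges_def)
  show "v ` {a..b} \<subseteq> \<Union>(walk_edges v a b)"
  proof
    fix x assume "x \<in> v ` {a..b}"
    then obtain t where t: "x = v t" "a \<le> t" "t \<le> b" by auto
    show "x \<in> \<Union>(walk_edges v a b)"
    proof (cases "t < b")
      case True
      then show ?thesis using t by (auto simp: walk_edges_def)
    next
      case False
      then have "{v (t - 1), v (Suc (t - 1))} \<in> walk_edges v a b" "Suc (t - 1) = t"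
        using t assms by (auto simp: walk_edges_def intro!: exI[of _ "t - 1"])
      then show ?thesis using t by (metis UnionI insertI1 insertI2)
    qed
  qed
qed

lemma Union_cycle_edges: "2 \<le> N \<Longrightarrow> \<Union>(cycle_edges v N) = v ` {0..N}"
  using Union_walk_edges[of 0 N v] by (auto simp: cycle_edges_def)

context connected_simple_graph
begin

lemma walk_same_side:
  assumes "a \<le> b" "\<And>t. a \<le> t \<Longrightarrow> t < b \<Longrightarrow> {v t, v (Suc t)} \<in> E - bd X"
  shows "v a \<in> X \<longleftrightarrow> v b \<in> X"
  using assms
proof (induction b rule: dec_induct)
  case (step n)
  then have "v a \<in> X \<longleftrightarrow> v n \<in> X" by simp
  moreover have "{v n, v (Suc n)} \<in> E - bd X" using step by simp
  ultimately show ?case by (simp add: in_bd_iff)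
qed simp

section \<open>A fixed cycle and the edge boundaries that meet it\<close>

context
  fixes v :: "nat \<Rightarrow> 'a" and N :: nat
  assumes N: "2 \<le> N" and inj: "inj_on v {0..N}" and cycE: "cycle_edges v N \<subseteq> E"
begin

lemma cycle_walk_E: "t < N \<Longrightarrow> {v t, v (Suc t)} \<in> E"
  using cycE by (auto simp: cycle_edges_def walk_edges_def)

lemma cycle_close_E: "{v N, v 0} \<in> E"
  using cycE by (auto simp: cycle_edges_def)

text \<open>A cycle does not cross a cut exactly once: the rest of the cycle is a path between the
  ends of \<open>c\<close> and would stay on one side.\<close>

lemma cycle_bd_not_unique:
  assumes c: "c \<in> cycle_edges v N" "c \<in> bd X"
  shows "\<exists>c'\<in>cycle_edges v N. c' \<in> bd X \<and> c' \<noteq> c"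
proof (rule ccontr)
  assume "\<not> ?thesis"
  then have other: "c' \<notin> bd X" if "c' \<in> cycle_edges v N" "c' \<noteq> c" for c' using that by blast
  have walk: "{v t, v (Suc t)} \<in> E - bd X" if "t < N" "{v t, v (Suc t)} \<noteq> c" for t
    using other[of "{v t, v (Suc t)}"] that cycle_walk_E by (auto simp: cycle_edges_def walk_edges_def)
  have close: "{v N, v 0} \<noteq> {v t, v (Suc t)}" if "t < N" for t
    using closing_edge_neq[OF inj N _ that] by (simp add: insert_commute)
  show False
  proof (cases "c = {v N, v 0}")
    case True
    then have "v 0 \<in> X \<longleftrightarrow> v N \<in> X"
      using close by (intro walk_same_side walk) auto
    then show False using c(2) True by (simp add: in_bd_iff)
  next
    case False
    then obtain t where t: "c = {v t, v (Suc t)}" "t < N"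
      using c(1) by (auto simp: cycle_edges_def walk_edges_def)
    have ne: "{v s, v (Suc s)} \<noteq> c" if "s < N" "s \<noteq> t" for s
      using walk_edge_eq_iff[OF inj, of s t] that t by simp
    have "v 0 \<in> X \<longleftrightarrow> v t \<in> X" using t ne by (intro walk_same_side walk) auto
    moreover have "v (Suc t) \<in> X \<longleftrightarrow> v N \<in> X" using t ne by (intro walk_same_side walk) auto
    moreover have "{v N, v 0} \<notin> bd X" using other False by (simp add: cycle_edges_def)
    then have "v N \<in> X \<longleftrightarrow> v 0 \<in> X" using cycle_close_E by (simp add: in_bd_iff)
    ultimately show False using c(2) t by (simp add: in_bd_iff)
  qed
qed

lemma cycle_edge_nonbridge: assumes "c \<in> cycle_edges v N" shows "nonbridge c"
  unfolding nonbridge_def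
proof (intro conjI allI notI)
  show "c \<in> E" using assms cycE by blast
  fix X assume X: "bd X = {c}"
  then have "c \<in> bd X" by simp
  then obtain c' where "c' \<in> bd X" "c' \<noteq> c" using cycle_bd_not_unique assms by blast
  then show False using X by simp
qed

text \<open>A cut with edges \<open>c\<close> and \<open>f\<close> would meet the cycle in
  \<open>c\<close> alone.\<close>

lemma not_parallel_cycle_edge:
  assumes "c \<in> cycle_edges v N" "f \<notin> cycle_edges v N" shows "f \<notin> parallel c"
proof
  assume "f \<in> parallel c"
  then have "cut_pair c f" using assms by (auto simp: parallel_def)
  then obtain X where X: "bd X = {c, f}" by (auto simp: cut_pair_def)
  then have "c \<in> bd X" by simp
  then obtain c' where "c' \<in> cycle_edges v N" "c' \<in> bd X" "c' \<noteq> c"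
    using cycle_bd_not_unique assms(1) by blast
  then show False using X assms(2) by auto
qed

lemma cycle_in_V: "v ` {0..N} \<subseteq> V"
  using Union_cycle_edges[OF N, of v] cycE edge_subset by blast

text \<open>If every edge off the cycle were a parent edge, then so would be \<open>f\<close>, say
  that of \<open>x\<close>, and the set \<open>X\<close> of \<open>x\<close> and its descendants
  would have \<open>f\<close> as its only boundary edge.\<close>

lemma non_tree_edge:
  assumes f: "nonbridge f" "f \<notin> cycle_edges v N"
  defines "S \<equiv> v ` {0..N}"
  shows "\<exists>h\<in>E. h \<notin> cycle_edges v N \<and> (\<forall>u\<in>V - S. h \<noteq> {u, parent S u})"
proof -
  have SV: "S \<subseteq> V" "S \<noteq> {}" using cycle_in_V by (auto simp: S_def)
  have fE: "f \<in> E" using f by (simp add: nonbridge_def)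
  show ?thesis
  proof (rule ccontr)
    assume "\<not> ?thesis"
    then have all: "e \<in> cycle_edges v N \<or> (\<exists>u\<in>V - S. e = {u, parent S u})" if "e \<in> E" for e
      using that by blast
    obtain x where x: "x \<in> V - S" "f = {x, parent S x}" using all fE f(2) by blast
    define P where "P = {(u, parent S u) | u. u \<in> V - S}"
    define X where "X = {u. (u, x) \<in> P\<^sup>*}"
    have X_layer: "layer S x \<le> layer S u" if "(u, x) \<in> P\<^sup>*" for u
      using that
    proof (induction rule: converse_rtrancl_induct)
      case (step y z)
      then have "y \<in> V - S" "z = parent S y" by (auto simp: P_def)
      then show ?case using step.IH parent_props(2)[OF SV, of y] by simp
    qed simp
    have X_step: "u \<in> X \<longleftrightarrow> u = x \<or> (u \<in> V - S \<and> parent S u \<in> X)" for u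
    proof
      assume "u \<in> X"
      then have "(u, x) \<in> P\<^sup>*" by (simp add: X_def)
      then show "u = x \<or> (u \<in> V - S \<and> parent S u \<in> X)"
        by (cases rule: converse_rtranclE) (auto simp: P_def X_def)
    next
      assume "u = x \<or> (u \<in> V - S \<and> parent S u \<in> X)"
      moreover have "(u, parent S u) \<in> P" if "u \<in> V - S" using that by (auto simp: P_def)
      ultimately show "u \<in> X" by (auto simp: X_def intro: converse_rtrancl_into_rtrancl)
    qed
    have "parent S x \<notin> X"
      using X_layer[of "parent S x"] parent_props(2)[OF SV x(1)] by (auto simp: X_def)
    then have fX: "f \<in> bd X" using fE x X_step[of x] by (simp add: in_bd_iff)
    have "e = f" if e: "e \<in> bd X" for e
    proof -
      have "e \<in> E" using e bd_subset by blast
      then show ?thesis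
      proof (cases "e \<in> cycle_edges v N")
        case True
        then have "e \<subseteq> S" using Union_cycle_edges[OF N, of v] by (auto simp: S_def)
        moreover have "u \<notin> X" if "u \<in> S" for u using X_step[of u] x that by blast
        ultimately have "e \<inter> X = {}" by blast
        then show ?thesis using e by (simp add: bd_def)
      next
        case False
        then obtain u where u: "u \<in> V - S" "e = {u, parent S u}" using all \<open>e \<in> E\<close> by blast
        then have "(u \<in> X) \<noteq> (parent S u \<in> X)" using e by (simp add: in_bd_iff)
        then have "u = x" using X_step[of u] u by blast
        then show ?thesis using u x by simp
      qed
    qed
    then have "bd X = {f}" using fX by blast
    then show False using f(1) by (simp add: nonbridge_def)
  qed
qed

end

text \<open>The graph formed by these edges is a theta graph or two cycles joined by a path.\<close>

definition double_lasso :: "(nat \<Rightarrow> 'a) \<Rightarrow> nat \<Rightarrow> nat \<Rightarrow> nat \<Rightarrow> bool" where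
  "double_lasso w M i j \<longleftrightarrow> inj_on w {0..M} \<and> walk_edges w 0 M \<subseteq> E \<and> 2 \<le> i \<and> i \<le> M \<and> j + 2 \<le> M \<and>
     {w 0, w i} \<in> E \<and> {w M, w j} \<in> E \<and> {w 0, w i} \<noteq> {w M, w j}"

text \<open>The first half of a double lasso, closed at its start by an edge of the cycle
  \<open>C\<close>. As \<open>S\<close> is covered, vertices off the path lie outside
  \<open>S\<close> and have parents.\<close>

definition lasso_path :: "'a set set \<Rightarrow> 'a set \<Rightarrow> 'a list \<Rightarrow> bool" where
  "lasso_path C S ps \<longleftrightarrow> distinct ps \<and> (\<forall>k. Suc k < length ps \<longrightarrow> {ps ! k, ps ! Suc k} \<in> E) \<and>
     (\<exists>i\<ge>2. i < length ps \<and> {ps ! 0, ps ! i} \<in> C) \<and> S \<subseteq> set ps"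

lemma lasso_path_append:
  assumes "lasso_path C S ps" "b \<notin> set ps" "{last ps, b} \<in> E"
  shows "lasso_path C S (ps @ [b])"
proof -
  obtain i where i: "2 \<le> i" "i < length ps" "{ps ! 0, ps ! i} \<in> C"
    using assms(1) by (auto simp: lasso_path_def)
  then have ne: "ps \<noteq> []" by auto
  have "{(ps @ [b]) ! k, (ps @ [b]) ! Suc k} \<in> E" if k: "Suc k < length (ps @ [b])" for k
  proof (cases "Suc k < length ps")
    case True
    then show ?thesis using assms(1) by (simp add: lasso_path_def nth_append)
  next
    case False
    then have "k = length ps - 1" using k by simp
    then show ?thesis using assms(3) ne by (simp add: nth_append last_conv_nth)
  qed
  moreover have "{(ps @ [b]) ! 0, (ps @ [b]) ! i} \<in> C" using i ne by (simp add: nth_append)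
  moreover have "distinct (ps @ [b])" "S \<subseteq> set (ps @ [b])" "i < length (ps @ [b])"
    using assms(1,2) i by (auto simp: lasso_path_def)
  ultimately show ?thesis using i(1) unfolding lasso_path_def by blast
qed

text \<open>The closing edge at the start is in \<open>C\<close> and the new one is not, so the two
  differ.\<close>

lemma lasso_path_close:
  assumes ps: "lasso_path C S ps" and C: "C \<subseteq> E" and h: "{last ps, ps ! j} \<in> E" "{last ps, ps ! j} \<notin> C"
    and j: "j + 2 < length ps"
  shows "\<exists>w M i j. double_lasso w M i j"
proof -
  obtain i where i: "2 \<le> i" "i < length ps" "{ps ! 0, ps ! i} \<in> C"
    using ps by (auto simp: lasso_path_def)
  have "ps \<noteq> []" using j by auto
  then have last: "last ps = ps ! (length ps - 1)" by (rule last_conv_nth)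
  have "inj_on ((!) ps) {0..length ps - 1}"
    using ps j by (auto simp: lasso_path_def inj_on_def nth_eq_iff_index_eq)
  moreover have "walk_edges ((!) ps) 0 (length ps - 1) \<subseteq> E"
    using ps by (auto simp: walk_edges_def lasso_path_def)
  ultimately have "double_lasso ((!) ps) (length ps - 1) i j"
    using i h j C last unfolding double_lasso_def by auto
  then show ?thesis by blast
qed

text \<open>The path is prolonged from parent to parent until the parent is already on it, at the
  latest in \<open>S\<close>; that edge closes the second lasso. The parent is not the predecessor
  on the path: at first by assumption, later because the predecessor is in a higher layer.\<close>

lemma lasso_path_climb:
  assumes C: "C \<subseteq> E" and S: "S = \<Union>C" "S \<noteq> {}"
    and "lasso_path C S qs" "last qs \<in> V - S" "qs ! (length qs - 2) \<noteq> parent S (last qs)"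
  shows "\<exists>w M i j. double_lasso w M i j"
  using assms(4-6)
proof (induction "layer S (last qs)" arbitrary: qs rule: less_induct)
  case less
  have SV: "S \<subseteq> V" using S C edge_subset by blast
  let ?b = "last qs" let ?p = "parent S (last qs)"
  have pE: "{?b, ?p} \<in> E" and pl: "Suc (layer S ?p) = layer S ?b"
    using parent_props[OF SV S(2)] less.prems by blast+
  obtain i where i: "2 \<le> i" "i < length qs" using less.prems by (auto simp: lasso_path_def)
  then have ne: "qs \<noteq> []" by auto
  show ?case
  proof (cases "?p \<in> set qs")
    case True
    then obtain j where j: "j < length qs" "qs ! j = ?p" by (auto simp: in_set_conv_nth)
    have "j \<noteq> length qs - 1" using j pE edgeD last_conv_nth[OF ne] by metis
    moreover have "j \<noteq> length qs - 2" using j less.prems by auto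
    ultimately have "j + 2 < length qs" using j by simp
    moreover have "{?b, ?p} \<notin> C" using less.prems(2) S(1) by blast
    ultimately show ?thesis using lasso_path_close[OF less.prems(1) C, of j] pE j by simp
  next
    case False
    have "lasso_path C S (qs @ [?p])" using less.prems False pE by (intro lasso_path_append)
    moreover have pVS: "?p \<in> V - S"
      using False less.prems(1) parent_in_V[OF SV S(2) less.prems(2)] by (auto simp: lasso_path_def)
    moreover have "(qs @ [?p]) ! (length (qs @ [?p]) - 2) = ?b"
      using ne by (simp add: nth_append last_conv_nth)
    moreover have "?b \<noteq> parent S ?p" using parent_props(2)[OF SV S(2) pVS] pl by auto
    ultimately show ?thesis using less.hyps[of "qs @ [?p]"] pl by simp
  qed
qed

context
  fixes v :: "nat \<Rightarrow> 'a" and N :: nat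
  assumes N: "2 \<le> N" and inj: "inj_on v {0..N}" and cycE: "cycle_edges v N \<subseteq> E"
begin

text \<open>The path runs around the cycle and then along parent edges to \<open>a\<close>. The
  bound on layers ensures that the next vertex is new, and the last clause keeps edges of any other
  kind off the path.\<close>

lemma lasso_path_to:
  fixes S defines "S \<equiv> v ` {0..N}"
  assumes "a \<in> V"
  shows "\<exists>ps. lasso_path (cycle_edges v N) S ps \<and> last ps = a \<and> (\<forall>u\<in>set ps. layer S u \<le> layer S a) \<and>
    (\<forall>k. Suc k < length ps \<longrightarrow> {ps ! k, ps ! Suc k} \<in> cycle_edges v N \<or>
       (\<exists>u\<in>V - S. {ps ! k, ps ! Suc k} = {u, parent S u}))"
  using assms(2)
proof (induction "layer S a" arbitrary: a)
  case 0
  have SV: "S \<subseteq> V" "S \<noteq> {}" using cycle_in_V[OF N inj cycE] by (auto simp: S_def)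
  then have "a \<in> S" using layer_0_iff 0 by metis
  then obtain t where t: "a = v t" "t \<le> N" by (auto simp: S_def)
  \<comment> \<open>Rotation by \<open>Suc t\<close> makes the tour start right after
    \<open>v t\<close> and end in \<open>v t\<close>.\<close>
  define ps where "ps = rotate (Suc t) (map v [0..<Suc N])"
  have len: "length ps = Suc N" by (simp add: ps_def)
  have set: "set ps = S" by (auto simp: ps_def S_def atLeastLessThanSuc_atLeastAtMost simp del: upt_Suc)
  have nth: "ps ! k = v ((Suc t + k) mod Suc N)" if "k < Suc N" for k
    using that unfolding ps_def by (subst nth_rotate) (auto simp del: upt_Suc)
  have cyc: "{v (s mod Suc N), v (Suc s mod Suc N)} \<in> cycle_edges v N" for s
  proof (cases "s mod Suc N = N")
    case True
    then show ?thesis by (simp add: mod_Suc cycle_edges_def)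
  next
    case False
    then have "s mod Suc N < N" using mod_less_divisor[of "Suc N" s] by linarith
    then show ?thesis using False by (auto simp: mod_Suc cycle_edges_def walk_edges_def)
  qed
  have edges: "{ps ! k, ps ! Suc k} \<in> cycle_edges v N" if "Suc k < length ps" for k
    using cyc[of "Suc t + k"] that len nth[of k] nth[of "Suc k"] by simp
  have lastn: "ps ! N = v t"
  proof -
    have "(Suc t + N) mod Suc N = t"
      using t by (metis add_Suc add_Suc_shift le_imp_less_Suc mod_add_self2 mod_less)
    then show ?thesis using nth[of N] by simp
  qed
  then have "last ps = a" using len t by (metis diff_Suc_1 last_conv_nth list.size(3) nat.distinct(1))
  moreover have "{ps ! 0, ps ! N} \<in> cycle_edges v N"
  proof -
    have "ps ! 0 = v (Suc t mod Suc N)" using nth[of 0] by simp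
    moreover have "t mod Suc N = t" using t by simp
    ultimately show ?thesis using cyc[of t] lastn by (simp add: insert_commute)
  qed
  moreover have "distinct ps" using inj by (simp add: ps_def distinct_map atLeastLessThanSuc_atLeastAtMost del: upt_Suc)
  ultimately have "lasso_path (cycle_edges v N) S ps"
    using edges set len N cycE unfolding lasso_path_def by (auto intro!: exI[of _ N])
  moreover have "\<forall>u\<in>set ps. layer S u \<le> layer S a"
  proof
    fix u assume "u \<in> set ps"
    then have "u \<in> S" using set by simp
    then have "layer S u = 0" using layer_0_iff[OF SV, of u] SV(1) by blast
    then show "layer S u \<le> layer S a" by simp
  qed
  ultimately show ?case using edges \<open>last ps = a\<close> by blast
next
  case (Suc n)
  have SV: "S \<subseteq> V" "S \<noteq> {}" using cycle_in_V[OF N inj cycE] by (auto simp: S_def)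
  then have aS: "a \<in> V - S" using layer_0_iff[OF SV] Suc by fastforce
  let ?p = "parent S a"
  have pE: "{a, ?p} \<in> E" and pl: "Suc (layer S ?p) = layer S a" using parent_props[OF SV aS] by auto
  obtain ps where ps: "lasso_path (cycle_edges v N) S ps" "last ps = ?p" "\<forall>u\<in>set ps. layer S u \<le> layer S ?p"
    "\<forall>k. Suc k < length ps \<longrightarrow> {ps ! k, ps ! Suc k} \<in> cycle_edges v N \<or>
       (\<exists>u\<in>V - S. {ps ! k, ps ! Suc k} = {u, parent S u})"
    using Suc.hyps(1)[of ?p] Suc.hyps(2) pl parent_in_V[OF SV aS] by auto
  obtain i where "i < length ps" using ps(1) by (auto simp: lasso_path_def)
  then have ne: "ps \<noteq> []" by auto
  have "a \<notin> set ps" using ps(3) pl by auto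
  moreover have pE': "{?p, a} \<in> E" using pE by (simp add: insert_commute)
  ultimately have "lasso_path (cycle_edges v N) S (ps @ [a])"
    using ps by (intro lasso_path_append) auto
  moreover have "\<forall>u\<in>set (ps @ [a]). layer S u \<le> layer S a" using ps(3) pl by auto
  moreover have "{(ps @ [a]) ! k, (ps @ [a]) ! Suc k} \<in> cycle_edges v N \<or>
       (\<exists>u\<in>V - S. {(ps @ [a]) ! k, (ps @ [a]) ! Suc k} = {u, parent S u})"
    if k: "Suc k < length (ps @ [a])" for k
  proof (cases "Suc k < length ps")
    case True
    then show ?thesis using ps(4) by (simp add: nth_append)
  next
    case False
    then have "k = length ps - 1" using k by simp
    then have "{(ps @ [a]) ! k, (ps @ [a]) ! Suc k} = {a, ?p}"
      using ps(2) ne by (auto simp: nth_append last_conv_nth)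
    then show ?thesis using aS by blast
  qed
  ultimately show ?case by (metis last_snoc)
qed

text \<open>Let \<open>h\<close> be neither a cycle edge nor a parent edge, and take a lasso path to
  its end \<open>a\<close>. If the other end \<open>b\<close> is on the path, then \<open>h\<close>
  closes the second lasso; otherwise \<open>b\<close> is appended and the path climbs from
  there.\<close>

lemma double_lasso_exists:
  assumes f: "nonbridge f" "f \<notin> cycle_edges v N"
  shows "\<exists>w M i j. double_lasso w M i j"
proof -
  define S where "S = v ` {0..N}"
  have SC: "S = \<Union>(cycle_edges v N)" using Union_cycle_edges[OF N, of v] by (simp add: S_def)
  have Sne: "S \<noteq> {}" by (simp add: S_def)
  obtain h where h: "h \<in> E" "h \<notin> cycle_edges v N" "\<And>u. u \<in> V - S \<Longrightarrow> h \<noteq> {u, parent S u}"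
    using non_tree_edge[OF N inj cycE f] unfolding S_def by blast
  obtain a b where ab: "h = {a, b}" "a \<noteq> b" "a \<in> V" "b \<in> V" using h(1) by (rule edge_cases)
  obtain ps where ps: "lasso_path (cycle_edges v N) S ps" "last ps = a"
    "\<forall>k. Suc k < length ps \<longrightarrow> {ps ! k, ps ! Suc k} \<in> cycle_edges v N \<or>
       (\<exists>u\<in>V - S. {ps ! k, ps ! Suc k} = {u, parent S u})"
    using lasso_path_to[OF ab(3)] unfolding S_def by blast
  obtain i where i: "2 \<le> i" "i < length ps" using ps(1) by (auto simp: lasso_path_def)
  then have ne: "ps \<noteq> []" by auto
  show ?thesis
  proof (cases "b \<in> set ps")
    case True
    then obtain j where j: "j < length ps" "ps ! j = b" by (auto simp: in_set_conv_nth)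
    have "j \<noteq> length ps - 1" using j ps(2) ab(2) last_conv_nth[OF ne] by metis
    \<comment> \<open>The last edge of the path is a cycle edge or a parent edge, hence not
      \<open>h\<close>.\<close>
    moreover have "j \<noteq> length ps - 2"
    proof
      assume "j = length ps - 2"
      then have "Suc j = length ps - 1" "Suc j < length ps" using i by auto
      then have "{ps ! j, ps ! Suc j} = h" using j ps(2) ab last_conv_nth[OF ne] by auto
      then show False using ps(3) \<open>Suc j < length ps\<close> h by metis
    qed
    ultimately have "j + 2 < length ps" using j by simp
    then show ?thesis using lasso_path_close[OF ps(1) cycE, of j] ps(2) j h ab by simp
  next
    case False
    have "lasso_path (cycle_edges v N) S (ps @ [b])"
      using ps ab h False by (intro lasso_path_append) auto
    moreover have "b \<in> V - S" using False ps(1) ab by (auto simp: lasso_path_def)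
    moreover have "(ps @ [b]) ! (length (ps @ [b]) - 2) = a"
      using ne ps(2) by (simp add: nth_append last_conv_nth)
    moreover have "a \<noteq> parent S b" using h(3)[of b] ab \<open>b \<in> V - S\<close> by (auto simp: insert_commute)
    ultimately show ?thesis using lasso_path_climb[OF cycE SC Sne, of "ps @ [b]"] by simp
  qed
qed

end

end

section \<open>Three labels and more than one cycle\<close>

context connected_simple_graph
begin

text \<open>Once \<open>F\<close> is preserved, \<open>tree_labeling_decode\<close> handles all
  vertices off \<open>F\<close>. On \<open>F\<close> only the invariance of \<phi> is demanded, not
  that vertices are fixed; the 4-cycle needs this weaker form.\<close>

lemma edge_distinguishable_tree_labeling:
  assumes \<phi>: "distinguishing_vertex_labeling V E \<phi>" "\<And>v. v \<in> V \<Longrightarrow> \<phi> v \<in> {1..r}" and r: "1 \<le> r"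
    and F: "F \<subseteq> E" "F \<noteq> {}" and p: "\<And>e. e \<in> E \<Longrightarrow> p e \<in> {1..r}"
    and core: "\<And>\<beta>. \<beta> \<in> automorphisms V E \<Longrightarrow>
        (\<And>e. e \<in> E \<Longrightarrow> tree_labeling (\<Union>F) \<phi> p r (\<beta> ` e) = tree_labeling (\<Union>F) \<phi> p r e) \<Longrightarrow> (`) \<beta> ` F = F"
    and rigid: "\<And>\<beta>. \<beta> \<in> automorphisms V E \<Longrightarrow> (`) \<beta> ` F = F \<Longrightarrow> (\<And>e. e \<in> F \<Longrightarrow> p (\<beta> ` e) = p e) \<Longrightarrow>
        (\<And>x. x \<in> \<Union>F \<Longrightarrow> \<phi> (\<beta> x) = \<phi> x)"
  shows "edge_distinguishable V E r"
  unfolding edge_distinguishable_def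
proof (intro exI conjI ballI impI)
  let ?S = "\<Union>F" let ?\<psi> = "tree_labeling (\<Union>F) \<phi> p r"
  have SV: "?S \<subseteq> V" using F edge_subset by blast
  have Sne: "?S \<noteq> {}" using F edge_cases by blast
  show "?\<psi> e \<in> {1..r}" if "e \<in> E" for e
    by (rule tree_labeling_range[OF SV Sne]) (use p \<phi>(2) r that in auto)
  fix \<beta> x assume \<beta>: "\<beta> \<in> automorphisms V E" and pres: "\<forall>e\<in>E. ?\<psi> (\<beta> ` e) = ?\<psi> e" and x: "x \<in> V"
  have \<beta>F: "(`) \<beta> ` F = F" using core[OF \<beta>] pres by blast
  then have \<beta>S: "\<beta> ` ?S = ?S" by (metis image_Union)
  have "p (\<beta> ` e) = p e" if e: "e \<in> F" for e
  proof -
    have "\<beta> ` e \<in> F" using \<beta>F e by blast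
    then have "e \<subseteq> ?S" "\<beta> ` e \<subseteq> ?S" using e by blast+
    then have "?\<psi> e = p e" "?\<psi> (\<beta> ` e) = p (\<beta> ` e)" by (auto simp: tree_labeling_def)
    then show ?thesis using pres e F by auto
  qed
  then have inS: "\<phi> (\<beta> y) = \<phi> y" if "y \<in> ?S" for y using rigid[OF \<beta> \<beta>F _ that] by blast
  have "\<phi> (\<beta> y) = \<phi> y" if "y \<in> V - ?S" for y
    using tree_labeling_decode[OF SV Sne \<beta> \<beta>S _ that, of \<phi> p r] pres by blast
  then have "\<forall>y\<in>V. \<phi> (\<beta> y) = \<phi> y" using inS by blast
  then show "\<beta> x = x" using \<phi>(1) \<beta> x by (simp add: distinguishing_vertex_labeling_def)
qed

text \<open>The double lasso \<open>F\<close> is labeled with 1 and 2, both different from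
  \<open>r\<close>, as \<open>core_preserved\<close> demands. The edges labeled 1 form a path, which
  is fixed or reversed by \<open>path_rigid\<close>; the edges labeled 2 exclude the
  reversal.\<close>

lemma double_lasso_distinguishable:
  assumes \<phi>: "distinguishing_vertex_labeling V E \<phi>" "\<And>v. v \<in> V \<Longrightarrow> \<phi> v \<in> {1..r}" and r: "3 \<le> r"
    and w: "double_lasso w M i j"
  shows "edge_distinguishable V E r"
proof -
  have inj: "inj_on w {0..M}" and walkE: "walk_edges w 0 M \<subseteq> E" and ij: "2 \<le> i" "i \<le> M" "j + 2 \<le> M"
    and gE: "{w 0, w i} \<in> E" and hE: "{w M, w j} \<in> E" and gh: "{w 0, w i} \<noteq> {w M, w j}"
    using w by (auto simp: double_lasso_def)
  define g where "g = {w 0, w i}"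
  define h where "h = {w M, w j}"
  define F where "F = walk_edges w 0 M \<union> {g, h}"
  \<comment> \<open>If \<open>i = M\<close> or \<open>j = 0\<close>, a reversal of the whole path
    maps \<open>g\<close> and \<open>h\<close> into \<open>{g, h}\<close> only if
    \<open>i = M\<close> and \<open>j = 0\<close>, that is, \<open>g = h\<close>. In the other case
    the reversal may be a symmetry, so the first edge also gets label 2 and the path of label 1
    starts at \<open>w 1\<close>.\<close>
  define H where "H = (if i \<noteq> M \<and> j \<noteq> 0 then {g, h, {w 0, w 1}} else {g, h})"
  define p where "p e = (if e \<notin> F then r else if e \<in> H then 2 else 1)" for e
  have eq: "w s = w t \<longleftrightarrow> s = t" if "s \<le> M" "t \<le> M" for s t
    using inj_on_eq_iff[OF inj] that by auto
  have FE: "F \<subseteq> E" using walkE gE hE by (auto simp: F_def g_def h_def)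
  have M: "0 < M" "2 \<le> M" using ij by auto
  have UF: "\<Union>F = w ` {0..M}"
    using Union_walk_edges[OF M(1), of w] ij by (auto simp: F_def g_def h_def)
  have gw: "g \<noteq> {w t, w (Suc t)}" if "t < M" for t
    unfolding g_def using closing_edge_neq[OF inj ij(1,2) that] .
  have hw: "h \<noteq> {w t, w (Suc t)}" if "t < M" for t
    unfolding h_def using that ij eq by (auto simp: doubleton_eq_iff)
  have walkF: "{w t, w (Suc t)} \<in> F" if "t < M" for t
    using that by (auto simp: F_def walk_edges_def)
  have HF: "H \<subseteq> F" using walkF[of 0] M by (auto simp: H_def F_def)
  have two: "\<exists>f\<in>F. \<exists>g\<in>F. f \<noteq> g \<and> x \<in> f \<and> x \<in> g" if x: "x \<in> \<Union>F" for x
  proof -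
    obtain t where t: "x = w t" "t \<le> M" using x unfolding UF by auto
    consider "t = 0" | "0 < t" "t < M" | "t = M" using t by linarith
    then show ?thesis
    proof cases
      case 1
      then show ?thesis using walkF[of 0] gw[of 0] M t
        by (intro bexI[of _ g] bexI[of _ "{w 0, w (Suc 0)}"]) (auto simp: F_def g_def)
    next
      case 2
      then obtain s where s: "t = Suc s" by (cases t) auto
      have "{w s, w (Suc s)} \<noteq> {w t, w (Suc t)}" using walk_edge_eq_iff[OF inj, of s t] 2 s by auto
      then show ?thesis using walkF[of s] walkF[of t] 2 s t
        by (intro bexI[of _ "{w s, w (Suc s)}"] bexI[of _ "{w t, w (Suc t)}"]) auto
    next
      case 3
      then obtain s where s: "M = Suc s" using M by (cases M) auto
      then show ?thesis using walkF[of s] hw[of s] 3 t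
        by (intro bexI[of _ h] bexI[of _ "{w s, w (Suc s)}"]) (auto simp: F_def h_def)
    qed
  qed
  have classes: "(`) \<beta> ` (F - H) \<subseteq> F - H \<and> (`) \<beta> ` H \<subseteq> H"
    if \<beta>F: "(`) \<beta> ` F = F" and pp: "\<And>e. e \<in> F \<Longrightarrow> p (\<beta> ` e) = p e" for \<beta>
  proof -
    have "\<beta> ` e \<in> F - H" if e: "e \<in> F - H" for e
    proof -
      have "\<beta> ` e \<in> F" "p (\<beta> ` e) = 1" using e \<beta>F pp[of e] by (auto simp: p_def)
      then show ?thesis by (auto simp: p_def split: if_splits)
    qed
    moreover have "\<beta> ` e \<in> H" if e: "e \<in> H" for e
    proof -
      have "\<beta> ` e \<in> F" "p (\<beta> ` e) = 2" using e HF \<beta>F pp[of e] by (auto simp: p_def)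
      then show ?thesis by (auto simp: p_def split: if_splits)
    qed
    ultimately show ?thesis by blast
  qed
  have rigid: "\<beta> x = x" if \<beta>: "\<beta> \<in> automorphisms V E" and \<beta>F: "(`) \<beta> ` F = F"
    and pp: "\<And>e. e \<in> F \<Longrightarrow> p (\<beta> ` e) = p e" and x: "x \<in> \<Union>F" for \<beta> x
  proof -
    have inj\<beta>: "inj \<beta>" by (rule aut_inj[OF \<beta>])
    have 1: "(`) \<beta> ` (F - H) \<subseteq> F - H" and 2: "(`) \<beta> ` H \<subseteq> H" using classes[OF \<beta>F pp] by auto
    have \<beta>g: "{\<beta> (w 0), \<beta> (w i)} \<in> H" and \<beta>h: "{\<beta> (w M), \<beta> (w j)} \<in> H"
      using 2 by (auto simp: H_def g_def h_def split: if_splits)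
    have "\<forall>t\<le>M. \<beta> (w t) = w t"
    proof (cases "i \<noteq> M \<and> j \<noteq> 0")
      case True
      then have H: "H = {g, h, {w 0, w 1}}" by (simp add: H_def)
      have "F - H = walk_edges w 1 M"
      proof
        show "F - H \<subseteq> walk_edges w 1 M"
        proof
          fix e assume e: "e \<in> F - H"
          then have "e \<in> walk_edges w 0 M" unfolding F_def H by blast
          then obtain t where t: "e = {w t, w (Suc t)}" "t < M" by (auto simp: walk_edges_def)
          have "t \<noteq> 0" using e t(1) by (auto simp: H)
          then show "e \<in> walk_edges w 1 M" using t by (auto simp: walk_edges_def)
        qed
        show "walk_edges w 1 M \<subseteq> F - H"
        proof
          fix e assume "e \<in> walk_edges w 1 M"
          then obtain t where t: "e = {w t, w (Suc t)}" "1 \<le> t" "t < M" by (auto simp: walk_edges_def)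
          moreover have "e \<noteq> {w 0, w 1}" using walk_edge_eq_iff[OF inj, of t 0] t by auto
          ultimately show "e \<in> F - H" using gw[of t] hw[of t] walkF[of t] by (auto simp: H)
        qed
      qed
      then have "(`) \<beta> ` walk_edges w 1 M \<subseteq> walk_edges w 1 M" using 1 by simp
      moreover have "inj_on w {1..M}" using inj by (rule inj_on_subset) auto
      ultimately have cases: "(\<forall>t. 1 \<le> t \<longrightarrow> t \<le> M \<longrightarrow> \<beta> (w t) = w t) \<or>
          (\<forall>t. 1 \<le> t \<longrightarrow> t \<le> M \<longrightarrow> \<beta> (w t) = w (1 + M - t))"
        using path_rigid[of w 1 M \<beta>] inj\<beta> M by simp
      have "\<beta> ` \<Union>F = \<Union>F" using \<beta>F by (metis image_Union)
      then have "\<beta> (w 0) \<in> w ` {0..M}" unfolding UF by auto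
      then obtain s where s: "\<beta> (w 0) = w s" "s \<le> M" by auto
      \<comment> \<open>The vertices \<open>w 1\<close> to \<open>w M\<close> are permuted among
        themselves, so only \<open>w 0\<close> is left as the image of \<open>w 0\<close>.\<close>
      have "s = 0"
      proof (rule ccontr)
        assume "s \<noteq> 0"
        then have "1 \<le> s" "s \<le> M" "1 \<le> 1 + M - s" "1 + M - s \<le> M" "1 + M - (1 + M - s) = s" using s by auto
        then have "\<exists>t. 1 \<le> t \<and> t \<le> M \<and> \<beta> (w t) = w s" using cases by metis
        then obtain t where "1 \<le> t" "t \<le> M" "\<beta> (w t) = \<beta> (w 0)" using s by auto
        then show False using inj\<beta> eq[of t 0] by (auto simp: inj_eq)
      qed
      from cases show ?thesis
      proof
        assume id: "\<forall>t. 1 \<le> t \<longrightarrow> t \<le> M \<longrightarrow> \<beta> (w t) = w t"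
        show ?thesis
        proof (intro allI impI)
          fix t assume "t \<le> M"
          then show "\<beta> (w t) = w t" using id s \<open>s = 0\<close> by (cases "t = 0") auto
        qed
      next
        assume rev: "\<forall>t. 1 \<le> t \<longrightarrow> t \<le> M \<longrightarrow> \<beta> (w t) = w (1 + M - t)"
        \<comment> \<open>The reversal would map the first edge to \<open>{w 0, w M}\<close>, which
          is not in \<open>H\<close> because \<open>i\<close> is not \<open>M\<close> and
          \<open>j\<close> is not 0.\<close>
        have "{\<beta> (w 0), \<beta> (w 1)} \<in> H" using 2 H by auto
        moreover have "\<beta> (w 1) = w M" using rev M by auto
        ultimately have "{w 0, w M} \<in> {g, h, {w 0, w 1}}" using s \<open>s = 0\<close> H by simp
        then show ?thesis using True ij M eq[of M i] eq[of 0 j] eq[of M 1] eq[of 0 i] eq[of 0 M]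
          by (auto simp: g_def h_def doubleton_eq_iff)
      qed
    next
      case False
      then have H: "H = {g, h}" by (auto simp: H_def)
      have "F - H = walk_edges w 0 M"
      proof
        show "F - H \<subseteq> walk_edges w 0 M" by (auto simp: F_def H)
        show "walk_edges w 0 M \<subseteq> F - H"
        proof
          fix e assume "e \<in> walk_edges w 0 M"
          then obtain t where t: "e = {w t, w (Suc t)}" "t < M" by (auto simp: walk_edges_def)
          then show "e \<in> F - H" using gw[of t] hw[of t] walkF[of t] by (auto simp: H)
        qed
      qed
      then have "(`) \<beta> ` walk_edges w 0 M \<subseteq> walk_edges w 0 M" using 1 by simp
      from path_rigid[OF inj M(1) inj\<beta> this] show ?thesis
      proof
        assume "\<forall>t\<ge>0. t \<le> M \<longrightarrow> \<beta> (w t) = w (0 + M - t)"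
        then have rev: "\<beta> (w t) = w (M - t)" if "t \<le> M" for t using that by simp
        have "{w M, w (M - i)} \<in> {g, h}" "{w 0, w (M - j)} \<in> {g, h}"
          using \<beta>g \<beta>h rev[of 0] rev[of i] rev[of M] rev[of j] ij H by auto
        then have a: "{w M, w (M - i)} = {w 0, w i} \<or> {w M, w (M - i)} = {w M, w j}"
          and b: "{w 0, w (M - j)} = {w 0, w i} \<or> {w 0, w (M - j)} = {w M, w j}"
          by (auto simp: g_def h_def)
        have iM: "\<not> (i = M \<and> j = 0)" using gh by (auto simp: insert_commute)
        have a': "(M = i \<and> M - i = 0) \<or> M - i = j"
          using a ij M eq[of M 0] eq[of M i] eq[of "M - i" 0] eq[of "M - i" i] eq[of "M - i" j] eq[of M j] eq[of "M - i" M]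
          by (auto simp: doubleton_eq_iff)
        have b': "M - j = i \<or> (j = 0 \<and> M - j = M)"
          using b ij M eq[of 0 i] eq[of "M - j" i] eq[of "M - j" 0] eq[of 0 M] eq[of 0 j] eq[of "M - j" M] eq[of "M - j" j]
          by (auto simp: doubleton_eq_iff)
        show ?thesis using a' b' iM False ij by auto
      qed auto
    qed
    then show ?thesis using x UF by auto
  qed
  show ?thesis
  proof (rule edge_distinguishable_tree_labeling[OF \<phi>])
    show "1 \<le> r" using r by simp
    show "F \<subseteq> E" by (rule FE)
    show Fne: "F \<noteq> {}" by (simp add: F_def)
    show "p e \<in> {1..r}" for e using r by (simp add: p_def)
    show "(`) \<beta> ` F = F" if "\<beta> \<in> automorphisms V E"
      "\<And>e. e \<in> E \<Longrightarrow> tree_labeling (\<Union>F) \<phi> p r (\<beta> ` e) = tree_labeling (\<Union>F) \<phi> p r e" for \<beta>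
      by (rule core_preserved[OF FE Fne two _ _ that]) (use r in \<open>auto simp: p_def\<close>)
    show "\<phi> (\<beta> x) = \<phi> x" if "\<beta> \<in> automorphisms V E" "(`) \<beta> ` F = F" "\<And>e. e \<in> F \<Longrightarrow> p (\<beta> ` e) = p e" "x \<in> \<Union>F" for \<beta> x
      using rigid[OF that] by simp
  qed
qed

end

section \<open>Exactly one cycle\<close>

context connected_simple_graph
begin

lemma distinguishing_edge_set_imp_distinguishable:
  assumes F: "distinguishing_edge_set F" shows "edge_distinguishable V E 2"
  unfolding edge_distinguishable_def
proof (intro exI conjI ballI impI)
  let ?\<psi> = "\<lambda>e. if e \<in> F then 2 else 1 :: nat"
  show "?\<psi> e \<in> {1..2}" for e by simp
  fix \<beta> x assume \<beta>: "\<beta> \<in> automorphisms V E" and pres: "\<forall>e\<in>E. ?\<psi> (\<beta> ` e) = ?\<psi> e" and x: "x \<in> V"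
  have FE: "F \<subseteq> E" using F by (simp add: distinguishing_edge_set_def)
  have "(`) \<beta> ` F = F"
  proof (rule endo_inj_surj)
    show "finite F" using FE finite_E finite_subset by blast
    show "(`) \<beta> ` F \<subseteq> F"
    proof
      fix g assume "g \<in> (`) \<beta> ` F"
      then obtain f where f: "f \<in> F" "g = \<beta> ` f" by blast
      then have "?\<psi> g = ?\<psi> f" using pres FE by blast
      then have "?\<psi> g = 2" using f(1) by simp
      then show "g \<in> F" by (simp split: if_splits)
    qed
    show "inj_on ((`) \<beta>) F" using inj_image_set[OF aut_inj[OF \<beta>]] inj_on_subset by blast
  qed
  then show "\<beta> x = x" using F \<beta> x by (simp add: distinguishing_edge_set_def)
qed

lemma distinguishing_vertex_set_label:
  assumes \<phi>: "distinguishing_vertex_labeling V E \<phi>" "\<And>v. v \<in> V \<Longrightarrow> \<phi> v \<in> {1..2}"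
  shows "distinguishing_vertex_set {x \<in> V. \<phi> x = 2}"
  unfolding distinguishing_vertex_set_def
proof (intro conjI ballI impI)
  let ?A = "{x \<in> V. \<phi> x = 2}"
  fix \<beta> x assume \<beta>: "\<beta> \<in> automorphisms V E" and im: "\<beta> ` ?A = ?A" and x: "x \<in> V"
  have "\<phi> (\<beta> y) = \<phi> y" if y: "y \<in> V" for y
  proof -
    have "\<beta> y \<in> ?A \<longleftrightarrow> y \<in> ?A" using inj_image_mem_iff[OF aut_inj[OF \<beta>], of y ?A] im by simp
    moreover have "\<beta> y \<in> V" using aut_in_V_iff[OF \<beta>] y by simp
    ultimately have "\<phi> (\<beta> y) = 2 \<longleftrightarrow> \<phi> y = 2" using y by simp
    moreover have "\<phi> y = 1 \<or> \<phi> y = 2" "\<phi> (\<beta> y) = 1 \<or> \<phi> (\<beta> y) = 2"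
      using \<phi>(2)[OF y] \<phi>(2)[OF \<open>\<beta> y \<in> V\<close>] by auto
    ultimately show ?thesis by auto
  qed
  then show "\<beta> x = x" using \<phi>(1) \<beta> x by (simp add: distinguishing_vertex_labeling_def)
qed simp

section \<open>A cycle that contains all nonbridge edges\<close>

context
  fixes v :: "nat \<Rightarrow> 'a" and N :: nat
  assumes N: "2 \<le> N" and inj: "inj_on v {0..N}" and cycE: "cycle_edges v N \<subseteq> E"
    and unicyclic: "\<And>f. nonbridge f \<Longrightarrow> f \<in> cycle_edges v N"
begin

lemma vertex_eq_iff: "s \<le> N \<Longrightarrow> t \<le> N \<Longrightarrow> v s = v t \<longleftrightarrow> s = t"
  using inj_on_eq_iff[OF inj] by auto

lemma cycle_edge_iff:
  assumes "s \<le> N" "t \<le> N"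
  shows "{v s, v t} \<in> cycle_edges v N \<longleftrightarrow> t = Suc s \<or> s = Suc t \<or> (s = 0 \<and> t = N) \<or> (s = N \<and> t = 0)"
proof
  assume "{v s, v t} \<in> cycle_edges v N"
  then consider "{v s, v t} = {v N, v 0}" | k where "k < N" "{v s, v t} = {v k, v (Suc k)}"
    by (auto simp: cycle_edges_def walk_edges_def)
  then show "t = Suc s \<or> s = Suc t \<or> (s = 0 \<and> t = N) \<or> (s = N \<and> t = 0)"
  proof cases
    case 1
    then show ?thesis using assms vertex_eq_iff[of s N] vertex_eq_iff[of s 0] vertex_eq_iff[of t N] vertex_eq_iff[of t 0]
      by (auto simp: doubleton_eq_iff)
  next
    case (2 k)
    then show ?thesis using assms vertex_eq_iff[of s k] vertex_eq_iff[of s "Suc k"] vertex_eq_iff[of t k] vertex_eq_iff[of t "Suc k"]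
      by (auto simp: doubleton_eq_iff)
  qed
next
  assume "t = Suc s \<or> s = Suc t \<or> (s = 0 \<and> t = N) \<or> (s = N \<and> t = 0)"
  then consider "t = Suc s" | "s = Suc t" | "s = 0" "t = N" | "s = N" "t = 0" by blast
  then show "{v s, v t} \<in> cycle_edges v N"
  proof cases
    case 1
    then show ?thesis using assms by (auto simp: cycle_edges_def walk_edges_def)
  next
    case 2
    then have "{v s, v t} = {v t, v (Suc t)}" "t < N" using assms by (auto simp: insert_commute)
    then show ?thesis by (auto simp: cycle_edges_def walk_edges_def)
  qed (auto simp: cycle_edges_def insert_commute)
qed

text \<open>The cycle consists of exactly the nonbridge edges, which every automorphism
  permutes.\<close>

lemma cycle_preserved: assumes \<beta>: "\<beta> \<in> automorphisms V E" shows "(`) \<beta> ` cycle_edges v N = cycle_edges v N"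
proof (rule endo_inj_surj)
  show "finite (cycle_edges v N)" using cycE finite_E finite_subset by blast
  show "(`) \<beta> ` cycle_edges v N \<subseteq> cycle_edges v N"
  proof
    fix g assume "g \<in> (`) \<beta> ` cycle_edges v N"
    then obtain f where "f \<in> cycle_edges v N" "g = \<beta> ` f" by blast
    then show "g \<in> cycle_edges v N"
      using unicyclic nonbridge_image[OF \<beta>] cycle_edge_nonbridge[OF N inj cycE] by simp
  qed
  show "inj_on ((`) \<beta>) (cycle_edges v N)" using inj_image_set[OF aut_inj[OF \<beta>]] inj_on_subset by blast
qed

lemma cycle_vertices_preserved:
  assumes \<beta>: "\<beta> \<in> automorphisms V E" shows "\<beta> ` (v ` {0..N}) = v ` {0..N}"
  unfolding Union_cycle_edges[OF N, symmetric]
  using cycle_preserved[OF \<beta>] by (metis image_Union)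

text \<open>As the cycle is preserved whatever its labels are, all labels including \<open>r\<close>
  may be used on it.\<close>

lemma unicyclic_distinguishable:
  assumes \<phi>: "distinguishing_vertex_labeling V E \<phi>" "\<And>v. v \<in> V \<Longrightarrow> \<phi> v \<in> {1..r}" and r: "1 \<le> r"
    and p: "\<And>e. p e \<in> {1..r}"
    and rigid: "\<And>\<beta> t. \<beta> \<in> automorphisms V E \<Longrightarrow> (\<And>e. e \<in> cycle_edges v N \<Longrightarrow> p (\<beta> ` e) = p e) \<Longrightarrow>
       t \<le> N \<Longrightarrow> \<phi> (\<beta> (v t)) = \<phi> (v t)"
  shows "edge_distinguishable V E r"
proof (rule edge_distinguishable_tree_labeling[OF \<phi> r cycE])
  show "cycle_edges v N \<noteq> {}" by (simp add: cycle_edges_def)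
  show "p e \<in> {1..r}" for e by (rule p)
  show "(`) \<beta> ` cycle_edges v N = cycle_edges v N" if "\<beta> \<in> automorphisms V E" for \<beta>
    by (rule cycle_preserved[OF that])
  show "\<phi> (\<beta> x) = \<phi> x" if "\<beta> \<in> automorphisms V E" "\<And>e. e \<in> cycle_edges v N \<Longrightarrow> p (\<beta> ` e) = p e"
    "x \<in> \<Union>(cycle_edges v N)" for \<beta> x
    using rigid[OF that(1,2)] that(3) unfolding Union_cycle_edges[OF N] by auto
qed

text \<open>The labels 2 and 3 occur once each on the cycle, on the two edges at \<open>v 0\<close>.
  This fixes \<open>v 0\<close> and \<open>v 1\<close>, so the path from \<open>v 1\<close> to
  \<open>v N\<close> is not reversed.\<close>

lemma unicyclic_three_labels:
  assumes \<phi>: "distinguishing_vertex_labeling V E \<phi>" "\<And>v. v \<in> V \<Longrightarrow> \<phi> v \<in> {1..r}" and r: "3 \<le> r"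
  shows "edge_distinguishable V E r"
proof -
  define p where "p e = (if e = {v N, v 0} then 2 else if e = {v 0, v 1} then 3 else 1 :: nat)" for e
  show ?thesis
  proof (rule unicyclic_distinguishable[OF \<phi>, where p = p])
    show "1 \<le> r" "p e \<in> {1..r}" for e using r by (auto simp: p_def)
    fix \<beta> t assume \<beta>: "\<beta> \<in> automorphisms V E" and pp: "\<And>e. e \<in> cycle_edges v N \<Longrightarrow> p (\<beta> ` e) = p e" and t: "t \<le> N"
    have eq: "s \<le> N \<Longrightarrow> t \<le> N \<Longrightarrow> v s = v t \<longleftrightarrow> s = t" for s t by (rule vertex_eq_iff)
    have ne: "{v N, v 0} \<noteq> {v 0, v 1}" using eq[of N 1] eq[of N 0] N by (auto simp: doubleton_eq_iff)
    have "p (\<beta> ` {v N, v 0}) = 2" "p (\<beta> ` {v 0, v 1}) = 3"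
      using pp[of "{v N, v 0}"] pp[of "{v 0, v 1}"] ne cycle_edge_iff[of N 0] cycle_edge_iff[of 0 1] N
      by (auto simp: p_def)
    then have im: "\<beta> ` {v N, v 0} = {v N, v 0}" "\<beta> ` {v 0, v 1} = {v 0, v 1}"
      by (auto simp: p_def split: if_splits)
    then have "{\<beta> (v N), \<beta> (v 0)} = {v N, v 0}" "{\<beta> (v 0), \<beta> (v 1)} = {v 0, v 1}" by simp_all
    then have fixed: "\<beta> (v 0) = v 0" "\<beta> (v 1) = v 1"
      using eq[of N 1] eq[of N 0] eq[of 0 1] N by (auto simp: doubleton_eq_iff)
    have "(`) \<beta> ` walk_edges v 1 N \<subseteq> walk_edges v 1 N"
    proof
      fix g assume "g \<in> (`) \<beta> ` walk_edges v 1 N"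
      then obtain k where k: "1 \<le> k" "k < N" "g = \<beta> ` {v k, v (Suc k)}" by (auto simp: walk_edges_def)
      have kC: "{v k, v (Suc k)} \<in> cycle_edges v N" using cycle_edge_iff[of k "Suc k"] k by simp
      have "{v k, v (Suc k)} \<noteq> {v N, v 0}" "{v k, v (Suc k)} \<noteq> {v 0, v 1}"
        using k N eq[of k N] eq[of k 0] eq[of "Suc k" 0] by (auto simp: doubleton_eq_iff)
      then have "g \<noteq> {v N, v 0}" "g \<noteq> {v 0, v 1}"
        using k(3) im inj_image_eq_iff[OF aut_inj[OF \<beta>]] by metis+
      moreover have "g \<in> cycle_edges v N" using cycle_preserved[OF \<beta>] kC k(3) by blast
      ultimately obtain l where l: "l < N" "g = {v l, v (Suc l)}"
        by (auto simp: cycle_edges_def walk_edges_def)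
      moreover have "l \<noteq> 0" using l \<open>g \<noteq> {v 0, v 1}\<close> by (intro notI) simp
      ultimately show "g \<in> walk_edges v 1 N" by (auto simp: walk_edges_def)
    qed
    moreover have "inj_on v {1..N}" using inj by (rule inj_on_subset) auto
    ultimately have "(\<forall>t. 1 \<le> t \<longrightarrow> t \<le> N \<longrightarrow> \<beta> (v t) = v t) \<or> (\<forall>t. 1 \<le> t \<longrightarrow> t \<le> N \<longrightarrow> \<beta> (v t) = v (1 + N - t))"
      using path_rigid[of v 1 N \<beta>] aut_inj[OF \<beta>] N by simp
    moreover have "\<beta> (v 1) \<noteq> v (1 + N - 1)" using fixed eq[of 1 N] N by simp
    ultimately have "\<beta> (v t) = v t" if "1 \<le> t" using that t N by fastforce
    then show "\<phi> (\<beta> (v t)) = \<phi> (v t)" using fixed by (cases "t = 0") auto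
  qed
qed

text \<open>Label 2 is put on the two edges at \<open>v 0\<close> and on \<open>{v 2, v 3}\<close>.
  Between the pair and the third edge there is one edge on one side and there are
  \<open>N - 3 \<ge> 2\<close> edges on the other, which excludes a reflection.\<close>

lemma unicyclic_two_labels_long:
  assumes \<phi>: "distinguishing_vertex_labeling V E \<phi>" "\<And>v. v \<in> V \<Longrightarrow> \<phi> v \<in> {1..2}" and N5: "5 \<le> N"
  shows "edge_distinguishable V E 2"
proof -
  define H where "H = {{v N, v 0}, {v 0, v 1}, {v 2, v 3}}"
  define p where "p e = (if e \<in> H then 2 else 1 :: nat)" for e
  show ?thesis
  proof (rule unicyclic_distinguishable[OF \<phi>, where p = p])
    show "1 \<le> (2 :: nat)" "p e \<in> {1..2}" for e by (auto simp: p_def)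
    fix \<beta> t assume \<beta>: "\<beta> \<in> automorphisms V E" and pp: "\<And>e. e \<in> cycle_edges v N \<Longrightarrow> p (\<beta> ` e) = p e" and t: "t \<le> N"
    have eq: "s \<le> N \<Longrightarrow> t \<le> N \<Longrightarrow> v s = v t \<longleftrightarrow> s = t" for s t by (rule vertex_eq_iff)
    have inj\<beta>: "inj \<beta>" by (rule aut_inj[OF \<beta>])
    have HC: "H \<subseteq> cycle_edges v N"
      using cycle_edge_iff[of N 0] cycle_edge_iff[of 0 1] cycle_edge_iff[of 2 3] N5 by (simp add: H_def)
    have \<beta>H: "\<beta> ` e \<in> H" if "e \<in> H" for e
      using pp[of e] that HC by (auto simp: p_def split: if_splits)
    have b0: "{\<beta> (v N), \<beta> (v 0)} \<in> H" and b1: "{\<beta> (v 0), \<beta> (v 1)} \<in> H" and b2: "{\<beta> (v 2), \<beta> (v 3)} \<in> H"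
      using \<beta>H[of "{v N, v 0}"] \<beta>H[of "{v 0, v 1}"] \<beta>H[of "{v 2, v 3}"] by (simp_all add: H_def)
    have dist: "v 0 \<noteq> v 1" "v 0 \<noteq> v 2" "v 0 \<noteq> v 3" "v 1 \<noteq> v 2" "v 1 \<noteq> v 3" "v 2 \<noteq> v 3"
      "v N \<noteq> v 0" "v N \<noteq> v 1" "v N \<noteq> v 2" "v N \<noteq> v 3"
      using eq N5 by auto
    have \<beta>dist: "\<beta> (v N) \<noteq> \<beta> (v 1)" "\<beta> (v 2) \<noteq> \<beta> (v 0)" "\<beta> (v 3) \<noteq> \<beta> (v 0)"
      using dist inj\<beta> by (auto simp: inj_eq)
    \<comment> \<open>\<open>v 0\<close> is the only vertex on two edges of
      \<open>H\<close>.\<close>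
    have fix0: "\<beta> (v 0) = v 0"
      using b0 b1 \<beta>dist(1) dist by (auto simp: H_def doubleton_eq_iff)
    have b2': "{\<beta> (v 2), \<beta> (v 3)} = {v 2, v 3}"
      using b2 \<beta>dist fix0 dist by (auto simp: H_def doubleton_eq_iff)
    have "\<beta> (v 1) = v 1"
    proof (rule ccontr)
      assume "\<beta> (v 1) \<noteq> v 1"
      then have "\<beta> (v 1) = v N" using b1 fix0 dist by (auto simp: H_def doubleton_eq_iff)
      moreover have "\<beta> (v 2) = v 2 \<or> \<beta> (v 2) = v 3" using b2' by (auto simp: doubleton_eq_iff)
      moreover have "{v 1, v 2} \<in> cycle_edges v N" using cycle_edge_iff[of 1 2] N5 by simp
      then have "\<beta> ` {v 1, v 2} \<in> cycle_edges v N" using cycle_preserved[OF \<beta>] by blast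
      ultimately have "{v N, v 2} \<in> cycle_edges v N \<or> {v N, v 3} \<in> cycle_edges v N" by auto
      then show False using cycle_edge_iff[of N 2] cycle_edge_iff[of N 3] N5 by auto
    qed
    then have fixN: "\<beta> (v N) = v N" using b0 fix0 \<beta>dist dist by (auto simp: H_def doubleton_eq_iff)
    then have im: "\<beta> ` {v N, v 0} = {v N, v 0}" using fix0 by simp
    have "(`) \<beta> ` walk_edges v 0 N \<subseteq> walk_edges v 0 N"
    proof
      fix g assume "g \<in> (`) \<beta> ` walk_edges v 0 N"
      then obtain k where k: "k < N" "g = \<beta> ` {v k, v (Suc k)}" by (auto simp: walk_edges_def)
      have kC: "{v k, v (Suc k)} \<in> cycle_edges v N" using cycle_edge_iff[of k "Suc k"] k by simp
      have "{v N, v 0} \<noteq> {v k, v (Suc k)}"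
        using closing_edge_neq[OF inj N _ k(1)] by (simp add: insert_commute)
      then have "g \<noteq> {v N, v 0}"
        using k(2) im inj_image_eq_iff[OF inj\<beta>] by metis
      moreover have "g \<in> cycle_edges v N" using cycle_preserved[OF \<beta>] kC k(2) by blast
      ultimately show "g \<in> walk_edges v 0 N" by (simp add: cycle_edges_def)
    qed
    from path_rigid[OF inj _ inj\<beta> this]
    have "(\<forall>t\<le>N. \<beta> (v t) = v t) \<or> (\<forall>t\<le>N. \<beta> (v t) = v (N - t))" using N by simp
    moreover have "\<beta> (v 0) \<noteq> v (N - 0)" using fix0 dist by simp
    ultimately show "\<phi> (\<beta> (v t)) = \<phi> (v t)" using t by auto
  qed
qed

text \<open>Every edge labeling of a 4-cycle with two labels has a nontrivial symmetry, so only the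
  values of \<phi> are kept invariant. Balance leaves three patterns, according to which vertex
  shares the label of \<open>v 0\<close>.\<close>

lemma unicyclic_two_labels_square:
  assumes \<phi>: "distinguishing_vertex_labeling V E \<phi>" "\<And>v. v \<in> V \<Longrightarrow> \<phi> v \<in> {1..2}" and N3: "N = 3"
    and bal: "card {t. t \<le> N \<and> \<phi> (v t) = 2} = 2"
  shows "edge_distinguishable V E 2"
proof -
  have eq: "s \<le> 3 \<Longrightarrow> t \<le> 3 \<Longrightarrow> v s = v t \<longleftrightarrow> s = t" for s t using vertex_eq_iff N3 by simp
  have dist: "v 0 \<noteq> v 1" "v 0 \<noteq> v 2" "v 0 \<noteq> v 3" "v 1 \<noteq> v 2" "v 1 \<noteq> v 3" "v 2 \<noteq> v 3"
    using eq by auto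
  have le3: "t \<le> 3 \<longleftrightarrow> t = 0 \<or> t = 1 \<or> t = 2 \<or> t = 3" for t :: nat by auto
  have lab: "\<phi> (v t) = 1 \<or> \<phi> (v t) = 2" if "t \<le> 3" for t
    using \<phi>(2)[of "v t"] cycle_in_V[OF N inj cycE] that N3 by (auto simp: subset_iff)
  have S: "v ` {0..N} = {v 0, v 1, v 2, v 3}"
    using N3 by (auto simp: le3 image_iff)
  have "{t. t \<le> N \<and> \<phi> (v t) = 2} = {0, 1, 2, 3} \<inter> {t. \<phi> (v t) = 2}"
    unfolding N3 le3 by blast
  then have "(\<Sum>t\<in>{0, 1, 2, 3}. if \<phi> (v t) = 2 then 1 else 0 :: nat) = 2"
    using bal by (subst sum.If_cases) auto
  then have "(if \<phi> (v 0) = 2 then 1 else 0) + (if \<phi> (v 1) = 2 then 1 else 0) +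
     (if \<phi> (v 2) = 2 then 1 else 0) + (if \<phi> (v 3) = 2 then 1 else 0) = (2 :: nat)" by simp
  moreover have "\<phi> (v 0) = 1 \<or> \<phi> (v 0) = 2" "\<phi> (v 1) = 1 \<or> \<phi> (v 1) = 2"
    "\<phi> (v 2) = 1 \<or> \<phi> (v 2) = 2" "\<phi> (v 3) = 1 \<or> \<phi> (v 3) = 2" by (rule lab, simp)+
  ultimately have cases: "(\<phi> (v 0) = \<phi> (v 1) \<and> \<phi> (v 2) = \<phi> (v 3)) \<or> (\<phi> (v 0) = \<phi> (v 3) \<and> \<phi> (v 1) = \<phi> (v 2)) \<or>
     (\<phi> (v 0) = \<phi> (v 2) \<and> \<phi> (v 1) = \<phi> (v 3))"
    by (elim disjE) simp_all
  \<comment> \<open>If equal labels are adjacent, marking one edge between equal labels leaves only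
    the reflection that exchanges equal labels. If they are opposite, marking the edges at
    \<open>v 0\<close> leaves only the reflection that fixes \<open>v 0\<close> and
    \<open>v 2\<close>.\<close>
  define H where "H = (if \<phi> (v 0) = \<phi> (v 1) \<and> \<phi> (v 2) = \<phi> (v 3) then {{v 0, v 1}}
     else if \<phi> (v 0) = \<phi> (v 3) \<and> \<phi> (v 1) = \<phi> (v 2) then {{v 0, v 3}} else {{v 0, v 1}, {v 0, v 3}})"
  define p where "p e = (if e \<in> H then 2 else 1 :: nat)" for e
  show ?thesis
  proof (rule unicyclic_distinguishable[OF \<phi>, where p = p])
    show "1 \<le> (2 :: nat)" "p e \<in> {1..2}" for e by (auto simp: p_def)
    fix \<beta> t assume \<beta>: "\<beta> \<in> automorphisms V E" and pp: "\<And>e. e \<in> cycle_edges v N \<Longrightarrow> p (\<beta> ` e) = p e" and t: "t \<le> N"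
    have inj\<beta>: "inj \<beta>" by (rule aut_inj[OF \<beta>])
    have "{v 0, v 1} \<in> cycle_edges v N" "{v 0, v 3} \<in> cycle_edges v N"
      using cycle_edge_iff[of 0 1] cycle_edge_iff[of 0 3] N3 by simp_all
    then have HC: "H \<subseteq> cycle_edges v N" by (auto simp: H_def)
    have \<beta>H: "\<beta> ` e \<in> H" if "e \<in> H" for e
      using pp[of e] that HC by (auto simp: p_def split: if_splits)
    have "\<beta> ` {v 0, v 1, v 2, v 3} = {v 0, v 1, v 2, v 3}"
      using cycle_vertices_preserved[OF \<beta>] S by simp
    then have mem: "\<beta> (v 0) \<in> {v 0, v 1, v 2, v 3}" "\<beta> (v 1) \<in> {v 0, v 1, v 2, v 3}"
      "\<beta> (v 2) \<in> {v 0, v 1, v 2, v 3}" "\<beta> (v 3) \<in> {v 0, v 1, v 2, v 3}" by blast+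
    have \<beta>dist: "\<beta> (v 0) \<noteq> \<beta> (v 1)" "\<beta> (v 0) \<noteq> \<beta> (v 2)" "\<beta> (v 0) \<noteq> \<beta> (v 3)" "\<beta> (v 1) \<noteq> \<beta> (v 2)"
      "\<beta> (v 1) \<noteq> \<beta> (v 3)" "\<beta> (v 2) \<noteq> \<beta> (v 3)" using dist inj\<beta> by (auto simp: inj_eq)
    have "\<phi> (\<beta> (v 0)) = \<phi> (v 0) \<and> \<phi> (\<beta> (v 1)) = \<phi> (v 1) \<and> \<phi> (\<beta> (v 2)) = \<phi> (v 2) \<and> \<phi> (\<beta> (v 3)) = \<phi> (v 3)"
    proof (cases "\<phi> (v 0) = \<phi> (v 1) \<and> \<phi> (v 2) = \<phi> (v 3)")
      case True
      then have "H = {{v 0, v 1}}" by (simp add: H_def)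
      then have "{\<beta> (v 0), \<beta> (v 1)} = {v 0, v 1}" using \<beta>H[of "{v 0, v 1}"] by simp
      then have "\<beta> (v 0) \<in> {v 0, v 1}" "\<beta> (v 1) \<in> {v 0, v 1}" "\<beta> (v 2) \<in> {v 2, v 3}" "\<beta> (v 3) \<in> {v 2, v 3}"
        using mem(3,4) \<beta>dist by (auto simp: doubleton_eq_iff)
      then show ?thesis using True by auto
    next
      case F1: False
      show ?thesis
      proof (cases "\<phi> (v 0) = \<phi> (v 3) \<and> \<phi> (v 1) = \<phi> (v 2)")
        case True
        then have "H = {{v 0, v 3}}" using F1 unfolding H_def by presburger
        then have "{\<beta> (v 0), \<beta> (v 3)} = {v 0, v 3}" using \<beta>H[of "{v 0, v 3}"] by simp
        then have "\<beta> (v 0) \<in> {v 0, v 3}" "\<beta> (v 3) \<in> {v 0, v 3}" "\<beta> (v 1) \<in> {v 1, v 2}" "\<beta> (v 2) \<in> {v 1, v 2}"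
          using mem(2,3) \<beta>dist by (auto simp: doubleton_eq_iff)
        then show ?thesis using True by auto
      next
        case False
        then have opp: "\<phi> (v 0) = \<phi> (v 2)" "\<phi> (v 1) = \<phi> (v 3)" using cases F1 by blast+
        have H: "H = {{v 0, v 1}, {v 0, v 3}}" using F1 False unfolding H_def by presburger
        have b: "{\<beta> (v 0), \<beta> (v 1)} \<in> H" "{\<beta> (v 0), \<beta> (v 3)} \<in> H"
          using \<beta>H[of "{v 0, v 1}"] \<beta>H[of "{v 0, v 3}"] by (simp_all add: H)
        have "\<beta> (v 0) = v 0"
          using b \<beta>dist(5) dist by (auto simp: H doubleton_eq_iff)
        moreover then have "\<beta> (v 1) \<in> {v 1, v 3}" "\<beta> (v 3) \<in> {v 1, v 3}"
          using b dist by (auto simp: H doubleton_eq_iff)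
        moreover then have "\<beta> (v 2) = v 2" using mem(3) \<beta>dist \<open>\<beta> (v 0) = v 0\<close> by auto
        ultimately show ?thesis using opp by auto
      qed
    qed
    then show "\<phi> (\<beta> (v t)) = \<phi> (v t)" using t N3 by (auto simp: le3)
  qed
qed

text \<open>An automorphism that exchanges \<open>A\<close> and its complement also does so on the
  cycle. Hence both labels occur equally often there, which leaves the balanced 4-cycle and cycles
  of length at least 6.\<close>

lemma unicyclic_two_labels:
  assumes \<phi>: "distinguishing_vertex_labeling V E \<phi>" "\<And>v. v \<in> V \<Longrightarrow> \<phi> v \<in> {1..2}"
  shows "edge_distinguishable V E 2"
proof -
  define A where "A = {x \<in> V. \<phi> x = 2}"
  have A: "distinguishing_vertex_set A" unfolding A_def by (rule distinguishing_vertex_set_label[OF \<phi>])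
  show ?thesis
  proof (cases "\<exists>\<alpha>\<in>automorphisms V E. \<alpha> ` A = V - A")
    case False
    then have "distinguishing_edge_set (bd A)" by (intro bd_distinguishing[OF A]) blast
    then show ?thesis by (rule distinguishing_edge_set_imp_distinguishable)
  next
    case True
    then obtain \<alpha> where \<alpha>: "\<alpha> \<in> automorphisms V E" "\<alpha> ` A = V - A" by blast
    define S where "S = v ` {0..N}"
    have SV: "S \<subseteq> V" using cycle_in_V[OF N inj cycE] by (simp add: S_def)
    have "\<alpha> ` (S \<inter> A) = S \<inter> (V - A)"
      using image_Int[OF aut_inj[OF \<alpha>(1)]] \<alpha>(2) cycle_vertices_preserved[OF \<alpha>(1)] by (simp add: S_def)
    then have "\<alpha> ` (S \<inter> A) = S - A" using SV by blast
    then have "card (S \<inter> A) = card (S - A)"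
      using card_image[OF inj_on_subset[OF aut_inj[OF \<alpha>(1)] subset_UNIV], of "S \<inter> A"] by simp
    moreover have "finite S" by (simp add: S_def)
    then have "card S = card (S \<inter> A) + card (S - A)" by (rule card_Int_Diff)
    moreover have "card S = Suc N" using card_image[OF inj] by (simp add: S_def)
    ultimately have cS: "Suc N = 2 * card (S \<inter> A)" by simp
    then have "N = 3 \<or> 5 \<le> N" using N by presburger
    then consider "N = 3" | "5 \<le> N" by blast
    then show ?thesis
    proof cases
      case 1
      have "S \<inter> A = v ` {t. t \<le> N \<and> \<phi> (v t) = 2}" using SV by (auto simp: S_def A_def)
      moreover have "inj_on v {t. t \<le> N \<and> \<phi> (v t) = 2}" using inj by (rule inj_on_subset) auto
      ultimately have "card {t. t \<le> N \<and> \<phi> (v t) = 2} = 2" using cS 1 by (simp add: card_image)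
      then show ?thesis using unicyclic_two_labels_square[OF \<phi>(1) _ 1] \<phi>(2) by simp
    next
      case 2
      then show ?thesis using unicyclic_two_labels_long[OF \<phi>(1)] \<phi>(2) by simp
    qed
  qed
qed

end

text \<open>A nonbridge edge off the given cycle is what separates more than one cycle from exactly
  one.\<close>

lemma cyclic_edge_distinguishable:
  assumes cyc: "has_cycle V E"
    and \<phi>: "distinguishing_vertex_labeling V E \<phi>" "\<And>v. v \<in> V \<Longrightarrow> \<phi> v \<in> {1..r}"
  shows "edge_distinguishable V E r"
proof -
  obtain xs where xs: "length xs \<ge> 3" "distinct xs" "\<forall>i. Suc i < length xs \<longrightarrow> {xs ! i, xs ! Suc i} \<in> E"
    "{last xs, hd xs} \<in> E" using cyc by (auto simp: has_cycle_def)
  define v where "v = (!) xs"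
  define N where "N = length xs - 1"
  have N: "2 \<le> N" using xs by (simp add: N_def)
  have inj: "inj_on v {0..N}"
    using xs by (auto simp: inj_on_def v_def N_def nth_eq_iff_index_eq)
  have ne: "xs \<noteq> []" using xs by auto
  have "{v N, v 0} \<in> E" using xs(4) ne by (simp add: v_def N_def last_conv_nth hd_conv_nth)
  moreover have "walk_edges v 0 N \<subseteq> E" using xs(3) by (auto simp: walk_edges_def v_def N_def)
  ultimately have cycE: "cycle_edges v N \<subseteq> E" by (simp add: cycle_edges_def)
  obtain x where "x \<in> V" using conn by (auto simp: connected_graph_def)
  then have "1 \<le> r" using \<phi>(2)[of x] by simp
  then consider "r = 1" | "r = 2" | "3 \<le> r" by linarith
  then show ?thesis
  proof cases
    case 1
    \<comment> \<open>With a single label every automorphism preserves \<phi>, so only the identity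
      exists.\<close>
    have "\<forall>x\<in>V. \<beta> x = x" if \<beta>: "\<beta> \<in> automorphisms V E" for \<beta>
    proof -
      have "\<phi> (\<beta> y) = \<phi> y" if "y \<in> V" for y
        using \<phi>(2)[OF that] \<phi>(2)[of "\<beta> y"] aut_in_V_iff[OF \<beta>, of y] that 1 by simp
      then show ?thesis using \<phi>(1) \<beta> by (simp add: distinguishing_vertex_labeling_def)
    qed
    then show ?thesis unfolding edge_distinguishable_def using 1 by (intro exI[of _ "\<lambda>_. 1"]) simp
  next
    case 2
    then have \<phi>2: "\<And>v. v \<in> V \<Longrightarrow> \<phi> v \<in> {1..2}" using \<phi>(2) by simp
    show ?thesis
    proof (cases "\<exists>f. nonbridge f \<and> f \<notin> cycle_edges v N")
      case True
      then obtain f where f: "nonbridge f" "f \<notin> cycle_edges v N" by blast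
      have c: "{v N, v 0} \<in> cycle_edges v N" by (simp add: cycle_edges_def)
      have "\<exists>F. distinguishing_edge_set F"
      proof (rule distinguishing_edge_set_if_two_classes)
        show "distinguishing_vertex_set {x \<in> V. \<phi> x = 2}"
          using \<phi>2 by (intro distinguishing_vertex_set_label[OF \<phi>(1)])
        show "nonbridge {v N, v 0}" by (rule cycle_edge_nonbridge[OF N inj cycE c])
        show "nonbridge f" by (rule f(1))
        show "f \<notin> parallel {v N, v 0}" by (rule not_parallel_cycle_edge[OF N inj cycE c f(2)])
      qed
      then show ?thesis using distinguishing_edge_set_imp_distinguishable 2 by blast
    next
      case False
      then show ?thesis using unicyclic_two_labels[OF N inj cycE _ \<phi>(1)] \<phi>2 2 by blast
    qed
  next
    case 3
    show ?thesis
    proof (cases "\<exists>f. nonbridge f \<and> f \<notin> cycle_edges v N")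
      case True
      then obtain w M i j where "double_lasso w M i j"
        using double_lasso_exists[OF N inj cycE] by blast
      then show ?thesis using double_lasso_distinguishable[OF \<phi>(1) _ 3] \<phi>(2) by simp
    next
      case False
      then show ?thesis using unicyclic_three_labels[OF N inj cycE _ \<phi>(1) _ 3] \<phi>(2) by blast
    qed
  qed
qed

end

theorem theorem2p1:
  fixes V :: "'a set" and E :: "'a set set"
  assumes "simple_graph V E" and "connected_graph V E" and "has_cycle V E"
  shows "distinguishing_index V E \<le> distinguishing_number V E"
proof -
  interpret connected_simple_graph V E using assms by unfold_locales
  define P where "P r \<longleftrightarrow> (\<exists>\<phi>. (\<forall>x\<in>V. \<phi> x \<in> {1..r}) \<and> distinguishing_vertex_labeling V E \<phi>)" for r
  define r where "r = distinguishing_number V E"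
  \<comment> \<open>An injective labeling shows that some number of labels suffices, so the least
    number in \<open>distinguishing_number\<close> is attained.\<close>
  obtain \<phi> where \<phi>: "bij_betw \<phi> V {1..card V}"
    using ex_bij_betw_finite_nat[OF finite_V]
    by (metis bij_betw_iff_card card_atLeastAtMost diff_Suc_1 finite_V finite_atLeastAtMost)
  have "\<beta> x = x" if \<beta>: "\<beta> \<in> automorphisms V E" and pres: "\<forall>x\<in>V. \<phi> (\<beta> x) = \<phi> x" and x: "x \<in> V" for \<beta> x
    using \<phi> pres x aut_in_V_iff[OF \<beta>, of x] by (auto simp: bij_betw_def dest: inj_onD)
  then have "distinguishing_vertex_labeling V E \<phi>"
    unfolding distinguishing_vertex_labeling_def by blast
  then have "P (card V)" using bij_betw_apply[OF \<phi>] unfolding P_def by blast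
  then have "P r" unfolding r_def distinguishing_number_def P_def by (rule LeastI)
  then obtain \<chi> where \<chi>: "distinguishing_vertex_labeling V E \<chi>" "\<And>x. x \<in> V \<Longrightarrow> \<chi> x \<in> {1..r}"
    by (auto simp: P_def)
  obtain \<psi> where \<psi>: "\<forall>e\<in>E. \<psi> e \<in> {1..r}"
    "\<forall>\<beta>\<in>automorphisms V E. (\<forall>e\<in>E. \<psi> (\<beta> ` e) = \<psi> e) \<longrightarrow> (\<forall>x\<in>V. \<beta> x = x)"
    using cyclic_edge_distinguishable[OF assms(3) \<chi>] unfolding edge_distinguishable_def by blast
  have "distinguishing_edge_labeling V E \<psi>"
    unfolding distinguishing_edge_labeling_def
  proof (intro ballI impI)
    fix \<alpha> x assume \<alpha>: "\<alpha> \<in> automorphisms V E" "\<forall>x y. {x, y} \<in> E \<longrightarrow> \<psi> {\<alpha> x, \<alpha> y} = \<psi> {x, y}" and x: "x \<in> V"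
    have "\<psi> (\<alpha> ` e) = \<psi> e" if e: "e \<in> E" for e
    proof -
      obtain u w where "e = {u, w}" using e by (rule edge_cases)
      then show ?thesis using \<alpha>(2) e by simp
    qed
    then show "\<alpha> x = x" using \<psi>(2) \<alpha>(1) x by blast
  qed
  then have "\<exists>\<psi>. (\<forall>e\<in>E. \<psi> e \<in> {1..r}) \<and> distinguishing_edge_labeling V E \<psi>" using \<psi>(1) by blast
  then have "distinguishing_index V E \<le> r" unfolding distinguishing_index_def by (rule Least_le)
  then show ?thesis by (simp add: r_def)
qed

end
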